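(* Let $L$ be a linear ordinary differential operator of order $4$ on an interval $I\subset\mathbb{R}$. Then the degree of the Wronski map $\mathrm{Wr}_{L,2}$ exceeds $1$ if and only if $L$ is equivalent to a self-adjoint linear ordinary differential operator.
   Context: A linear ordinary differential operator (ODO) of order $n$ on an interval $I\subset\mathbb{R}$ is $L\,x(t)=x^{(n)}(t)+a_{n-1}(t)x^{(n-1)}(t)+\cdots+a_0(t)x(t)$, where $a_0,\dots,a_{n-1}$ are smooth complex-valued functions on $I$. $V_L$ is the $n$-dimensional complex vector space of complex-valued solutions of $Lx=0$. The Wronskian of $f_1,\dots,f_m$ is $\mathrm{Wr}(f_1,\dots,f_m)=\det\bigl(f_j^{(i-1)}(t)\bigr)_{i,j=1}^m$. For $1\le m\le n-1$, the Wronski map $\mathrm{Wr}_{L,m}\colon\mathrm{Gr}_mV_L\to\mathbb{P}C^\infty(I)$ sends an $m$-dimensional subspace $\Lambda\subset V_L$ with basis $f_1,\dots,f_m$ to the line spanned by $\mathrm{Wr}(f_1,\dots,f_m)$, which is not identically zero and up to a nonzero scalar depends only on $\Lambda$. The map is induced by the linear map $\bigwedge^mV_L\to C^\infty(I)$, $f_1\wedge\cdots\wedge f_m\mapsto\mathrm{Wr}(f_1,\dots,f_m)$, so it takes values in a finite-dimensional projective space and its image is a projective variety. The degree of the Wronski map is its degree as a map onto its image: the constant number of points in the preimage of a point $y$, for $y$ in an open dense subset of the image. The (formal) adjoint of $L$ is $L^*x(t)=(-1)^nx^{(n)}(t)+\sum_{i=0}^{n-1}(-1)^i(a_ix)^{(i)}(t)$,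 and $L$ is self-adjoint if $L^*=L$. Two linear ODOs $L,\widetilde L$ on $I$ are equivalent if there is a smooth nonvanishing (complex-valued) function $\mu$ on $I$ with $\widetilde Lx=\frac1\mu L(\mu x)$. *)

theory Defs
  imports
    "HOL-Analysis.Analysis"
    "HOL-Library.Function_Algebras"
    "Jordan_Normal_Form.Determinant"
begin

section \<open>Smooth functions on an interval\<close>

text \<open>
  \<open>I\<close> is any nondegenerate interval, so derivatives are taken within \<open>I\<close> (one-sided at an endpoint
  that belongs to \<open>I\<close>). Derivatives are set to zero off \<open>I\<close>.
\<close>

definition nderiv :: "real set \<Rightarrow> nat \<Rightarrow> (real \<Rightarrow> complex) \<Rightarrow> real \<Rightarrow> complex" where
  "nderiv I k = ((\<lambda>f t. if t \<in> I then vector_derivative f (at t within I) else 0) ^^ k)"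

definition smooth_on :: "real set \<Rightarrow> (real \<Rightarrow> complex) \<Rightarrow> bool" where
  "smooth_on I f \<longleftrightarrow> (\<forall>k. \<forall>t\<in>I. nderiv I k f differentiable (at t within I))"

text \<open>
  The vector space of smooth functions on \<open>I\<close>: a function on \<open>I\<close> is represented by its extension
  by zero, so that equality in this set is equality of functions on \<open>I\<close>.
\<close>

definition Cinf :: "real set \<Rightarrow> (real \<Rightarrow> complex) set" where
  "Cinf I = {f. smooth_on I f \<and> (\<forall>t. t \<notin> I \<longrightarrow> f t = 0)}"

definition cscale :: "complex \<Rightarrow> (real \<Rightarrow> complex) \<Rightarrow> real \<Rightarrow> complex" where
  "cscale c f = (\<lambda>t. c * f t)"

global_interpretation cfun: vector_space cscale
  by standard (simp_all add: cscale_def fun_eq_iff algebra_simps)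


section \<open>Linear ordinary differential operators\<close>

text \<open>
  The record with \<open>ldo_order = n\<close> and \<open>ldo_coeff = a\<close> stands for the monic operator with
  \<open>L x = x\<^sup>(\<^sup>n\<^sup>) + a (n - 1) x\<^sup>(\<^sup>n\<^sup>-\<^sup>1\<^sup>) + \<dots> + a 0 x\<close>; the values \<open>a i\<close> with \<open>i \<ge> n\<close> are irrelevant.
\<close>

record ldo =
  ldo_order :: nat
  ldo_coeff :: "nat \<Rightarrow> real \<Rightarrow> complex"

definition ldo_on :: "real set \<Rightarrow> ldo \<Rightarrow> bool" where
  "ldo_on I L \<longleftrightarrow> (\<forall>i<ldo_order L. smooth_on I (ldo_coeff L i))"

definition ldo_apply :: "real set \<Rightarrow> ldo \<Rightarrow> (real \<Rightarrow> complex) \<Rightarrow> real \<Rightarrow> complex" where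
  "ldo_apply I L x t =
     nderiv I (ldo_order L) x t + (\<Sum>i<ldo_order L. ldo_coeff L i t * nderiv I i x t)"

definition adjoint_apply :: "real set \<Rightarrow> ldo \<Rightarrow> (real \<Rightarrow> complex) \<Rightarrow> real \<Rightarrow> complex" where
  "adjoint_apply I L x t =
     (-1) ^ ldo_order L * nderiv I (ldo_order L) x t
     + (\<Sum>i<ldo_order L. (-1) ^ i * nderiv I i (\<lambda>s. ldo_coeff L i s * x s) t)"

definition ldo_self_adjoint :: "real set \<Rightarrow> ldo \<Rightarrow> bool" where
  "ldo_self_adjoint I L \<longleftrightarrow> (\<forall>x\<in>Cinf I. \<forall>t\<in>I. adjoint_apply I L x t = ldo_apply I L x t)"

definition ldo_equivalent :: "real set \<Rightarrow> ldo \<Rightarrow> ldo \<Rightarrow> bool" where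
  "ldo_equivalent I L M \<longleftrightarrow>
     (\<exists>\<mu>. smooth_on I \<mu> \<and> (\<forall>t\<in>I. \<mu> t \<noteq> 0) \<and>
       (\<forall>x\<in>Cinf I. \<forall>t\<in>I. ldo_apply I M x t = 1 / \<mu> t * ldo_apply I L (\<lambda>s. \<mu> s * x s) t))"

definition sol_space :: "real set \<Rightarrow> ldo \<Rightarrow> (real \<Rightarrow> complex) set" where
  "sol_space I L = {x \<in> Cinf I. \<forall>t\<in>I. ldo_apply I L x t = 0}"


section \<open>The Wronski map\<close>

definition wronskian :: "real set \<Rightarrow> (real \<Rightarrow> complex) list \<Rightarrow> real \<Rightarrow> complex" where
  "wronskian I fs t =
     Determinant.det (Matrix.mat (length fs) (length fs) (\<lambda>(i, j). nderiv I i (fs ! j) t))"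

definition grassmannian :: "nat \<Rightarrow> (real \<Rightarrow> complex) set \<Rightarrow> (real \<Rightarrow> complex) set set" where
  "grassmannian m V = {\<Lambda>. cfun.subspace \<Lambda> \<and> \<Lambda> \<subseteq> V \<and> cfun.dim \<Lambda> = m}"

definition is_basis_list :: "(real \<Rightarrow> complex) list \<Rightarrow> (real \<Rightarrow> complex) set \<Rightarrow> bool" where
  "is_basis_list fs \<Lambda> \<longleftrightarrow> distinct fs \<and> cfun.independent (set fs) \<and> cfun.span (set fs) = \<Lambda>"

text \<open>The line does not depend on the basis that is chosen.\<close>

definition wronski_map :: "real set \<Rightarrow> (real \<Rightarrow> complex) set \<Rightarrow> (real \<Rightarrow> complex) set" where
  "wronski_map I \<Lambda> = cfun.span {wronskian I (SOME fs. is_basis_list fs \<Lambda>)}"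


section \<open>Zariski topology on the projective space of functions\<close>

definition proj_space :: "(real \<Rightarrow> complex) set set" where
  "proj_space = {cfun.span {f} | f. f \<noteq> 0}"

inductive homog_poly :: "nat \<Rightarrow> ((real \<Rightarrow> complex) \<Rightarrow> complex) \<Rightarrow> bool" where
  homog_poly_const: "homog_poly 0 (\<lambda>_. c)"
| homog_poly_add: "homog_poly d p \<Longrightarrow> homog_poly d q \<Longrightarrow> homog_poly d (\<lambda>x. p x + q x)"
| homog_poly_linear_mult: "Vector_Spaces.linear cscale (*) \<phi> \<Longrightarrow> homog_poly d p \<Longrightarrow>
    homog_poly (Suc d) (\<lambda>x. \<phi> x * p x)"

definition zero_locus :: "((real \<Rightarrow> complex) \<Rightarrow> complex) set \<Rightarrow> (real \<Rightarrow> complex) set set" where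
  "zero_locus F = {l \<in> proj_space. \<forall>p\<in>F. \<forall>x\<in>l. p x = 0}"

text \<open>
  A linear functional on a subspace extends to the whole space, so on the projective space of a
  finite-dimensional space of functions this topology induces the usual Zariski topology.
\<close>

definition zariski :: "(real \<Rightarrow> complex) set topology" where
  "zariski = topology (\<lambda>U. \<exists>F. (\<forall>p\<in>F. \<exists>d. homog_poly d p) \<and> U = proj_space - zero_locus F)"

lemma homog_poly_scale: "homog_poly d p \<Longrightarrow> homog_poly d (\<lambda>x. c * p x)"
proof (induction rule: homog_poly.induct)
  case (homog_poly_const b)
  show ?case by (rule homog_poly.homog_poly_const)
next
  case (homog_poly_add d p q)
  show ?case
    unfolding distrib_left by (rule homog_poly.homog_poly_add[OF homog_poly_add.IH])
next
  case (homog_poly_linear_mult \<phi> d p)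
  show ?case
    unfolding mult.left_commute[of c]
    by (rule homog_poly.homog_poly_linear_mult[OF homog_poly_linear_mult.hyps(1) homog_poly_linear_mult.IH])
qed

lemma homog_poly_mult:
  assumes "homog_poly d p" and q: "homog_poly e q"
  shows "homog_poly (d + e) (\<lambda>x. p x * q x)"
  using assms(1)
proof (induction rule: homog_poly.induct)
  case (homog_poly_const c)
  show ?case using homog_poly_scale[OF q] by simp
next
  case (homog_poly_add d p p')
  show ?case
    unfolding distrib_right by (rule homog_poly.homog_poly_add[OF homog_poly_add.IH])
next
  case (homog_poly_linear_mult \<phi> d p)
  show ?case
    unfolding mult.assoc add_Suc
    by (rule homog_poly.homog_poly_linear_mult[OF homog_poly_linear_mult.hyps(1) homog_poly_linear_mult.IH])
qed

lemma homog_poly_homogeneous: "homog_poly d p \<Longrightarrow> p (cscale c x) = c ^ d * p x"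
proof (induction rule: homog_poly.induct)
  case (homog_poly_linear_mult \<phi> d p)
  then have "\<phi> (cscale c x) = c * \<phi> x"
    using module_hom.scale[of cscale "(*)" \<phi>] by (simp add: module_hom_iff_linear)
  with homog_poly_linear_mult.IH show ?case by simp
qed (simp_all add: algebra_simps)

lemma zero_on_line_iff:
  assumes "homog_poly d p"
  shows "(\<forall>x \<in> cfun.span {f}. p x = 0) \<longleftrightarrow> p f = 0"
  using cfun.span_base[of f "{f}"]
  by (auto simp: cfun.span_singleton homog_poly_homogeneous[OF assms])

lemma zero_locus_Un:
  assumes F: "\<forall>p\<in>F. \<exists>d. homog_poly d p" and G: "\<forall>q\<in>G. \<exists>d. homog_poly d q"
  shows "zero_locus F \<union> zero_locus G = zero_locus {\<lambda>x. p x * q x | p q. p \<in> F \<and> q \<in> G}"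
    (is "_ = zero_locus ?H")
proof (rule Set.set_eqI)
  fix l
  have H: "\<forall>r\<in>?H. \<exists>d. homog_poly d r"
    using F G homog_poly_mult by blast
  show "l \<in> zero_locus F \<union> zero_locus G \<longleftrightarrow> l \<in> zero_locus ?H"
  proof (cases "l \<in> proj_space")
    case True
    then obtain f where l: "l = cfun.span {f}"
      by (auto simp: proj_space_def)
    have *: "l \<in> zero_locus K \<longleftrightarrow> (\<forall>p\<in>K. p f = 0)" if "\<forall>p\<in>K. \<exists>d. homog_poly d p" for K
      using that True zero_on_line_iff unfolding zero_locus_def l by blast
    show ?thesis
      unfolding Un_iff *[OF F] *[OF G] *[OF H]
    proof
      assume R: "\<forall>r\<in>?H. r f = 0"
      have "p f * q f = 0" if "p \<in> F" "q \<in> G" for p q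
        using R that by (metis (mono_tags, lifting) mem_Collect_eq)
      then show "(\<forall>p\<in>F. p f = 0) \<or> (\<forall>q\<in>G. q f = 0)"
        by (metis mult_eq_0_iff)
    next
      assume "(\<forall>p\<in>F. p f = 0) \<or> (\<forall>q\<in>G. q f = 0)"
      then show "\<forall>r\<in>?H. r f = 0"
        by (elim disjE) auto
    qed
  qed (simp add: zero_locus_def)
qed

lemma openin_zariski:
  "openin zariski U \<longleftrightarrow> (\<exists>F. (\<forall>p\<in>F. \<exists>d. homog_poly d p) \<and> U = proj_space - zero_locus F)"
proof -
  let ?O = "\<lambda>U. \<exists>F. (\<forall>p\<in>F. \<exists>d. homog_poly d p) \<and> U = proj_space - zero_locus F"
  have "istopology ?O"
    unfolding istopology_def
  proof (intro conjI allI impI)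
    fix S T assume "?O S" "?O T"
    then obtain F G where F: "\<forall>p\<in>F. \<exists>d. homog_poly d p" "S = proj_space - zero_locus F"
      and G: "\<forall>p\<in>G. \<exists>d. homog_poly d p" "T = proj_space - zero_locus G"
      by blast
    let ?H = "{\<lambda>x. p x * q x | p q. p \<in> F \<and> q \<in> G}"
    have "\<forall>r\<in>?H. \<exists>d. homog_poly d r"
      using F(1) G(1) homog_poly_mult by blast
    moreover have "S \<inter> T = proj_space - zero_locus ?H"
      unfolding F(2) G(2) zero_locus_Un[OF F(1) G(1), symmetric] by blast
    ultimately show "?O (S \<inter> T)"
      by blast
  next
    fix \<K> assume "\<forall>K\<in>\<K>. ?O K"
    then obtain F where F: "\<And>K. K \<in> \<K> \<Longrightarrow> (\<forall>p\<in>F K. \<exists>d. homog_poly d p)"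
      "\<And>K. K \<in> \<K> \<Longrightarrow> K = proj_space - zero_locus (F K)"
      by metis
    have "(\<lambda>K. proj_space - zero_locus (F K)) ` \<K> = (\<lambda>K. K) ` \<K>"
      by (rule image_cong[OF refl]) (rule F(2)[symmetric])
    then have "\<Union>\<K> = (\<Union>K\<in>\<K>. proj_space - zero_locus (F K))"
      by simp
    also have "\<dots> = proj_space - zero_locus (\<Union>(F ` \<K>))"
      by (auto simp: zero_locus_def)
    finally have "\<Union>\<K> = proj_space - zero_locus (\<Union>(F ` \<K>))" .
    moreover have "\<forall>p\<in>\<Union>(F ` \<K>). \<exists>d. homog_poly d p"
      using F(1) by fast
    ultimately show "?O (\<Union>\<K>)"
      by (intro exI[of _ "\<Union>(F ` \<K>)"] conjI)
  qed
  then show ?thesis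
    unfolding zariski_def by (simp)
qed


section \<open>The degree of the Wronski map\<close>

definition wronski_image :: "real set \<Rightarrow> ldo \<Rightarrow> nat \<Rightarrow> (real \<Rightarrow> complex) set set" where
  "wronski_image I L m = wronski_map I ` grassmannian m (sol_space I L)"

definition wronski_degree :: "real set \<Rightarrow> ldo \<Rightarrow> nat \<Rightarrow> nat" where
  "wronski_degree I L m = (THE d. \<exists>U.
     openin (subtopology zariski (wronski_image I L m)) U \<and>
     (subtopology zariski (wronski_image I L m)) closure_of U = wronski_image I L m \<and>
     (\<forall>y\<in>U. finite {\<Lambda> \<in> grassmannian m (sol_space I L). wronski_map I \<Lambda> = y} \<and>
            card {\<Lambda> \<in> grassmannian m (sol_space I L). wronski_map I \<Lambda> = y} = d))"

end

theory Submission
  imports Defs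
begin

text \<open>
  Let \<open>V\<close> be the four-dimensional solution space of \<open>L\<close> and
  \<open>W : \<And>\<^sup>2 V \<rightarrow> C\<^sup>\<infinity>(I)\<close> the linear map induced by the Wronskian. A plane in \<open>V\<close> is a
  point of the Klein quadric, the set of decomposable bivectors in the projective space of
  \<open>\<And>\<^sup>2 V\<close>, and the Wronski map is the linear projection of this quadric from the kernel of \<open>W\<close>.
  No decomposable bivector lies in the kernel. If the kernel is zero, then the projection is injective
  and has degree 1. If it is spanned by one bivector, a point off the quadric, then a general line
  through this point meets the quadric twice and the degree is 2. So the theorem says that \<open>W\<close> has
  a kernel precisely when \<open>L\<close> is equivalent to a self-adjoint operator.

  Conjugation with a nonvanishing function \<open>\<mu>\<close> multiplies solutions by \<open>1 / \<mu>\<close>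
  and Wronskians by \<open>1 / \<mu>\<^sup>2\<close>, so the kernel does not change, and \<open>\<mu>\<close> can be chosen such that
  the new operator \<open>M x = x'''' + b\<^sub>2 x'' + b\<^sub>1 x' + b\<^sub>0 x\<close> has no term of order 3
  (\<open>ldo_reduced_form\<close>). Such an \<open>M\<close> is self-adjoint if and only if \<open>b\<^sub>1 = b\<^sub>2'\<close>
  (\<open>self_adjoint_order_4_iff\<close>).

  For a bivector \<open>p\<close> and the functionals \<open>x \<mapsto> x\<^sup>(\<^sup>i\<^sup>) t\<close> on the solutions of \<open>M\<close>, let
  \<open>S\<^sub>i\<^sub>j t\<close> be the value of \<open>p\<close> on the functionals number \<open>i\<close> and \<open>j\<close>. Then \<open>S\<^sub>0\<^sub>1\<close> is the
  Wronskian of \<open>p\<close>, and \<open>S\<^sub>i\<^sub>j' = S\<^sub>i\<^sub>+\<^sub>1\<^sub>,\<^sub>j + S\<^sub>i\<^sub>,\<^sub>j\<^sub>+\<^sub>1\<close>. If \<open>S\<^sub>0\<^sub>1 = 0\<close>, repeated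
  differentiation yields \<open>S\<^sub>0\<^sub>2 = S\<^sub>1\<^sub>3 = 0\<close>, \<open>S\<^sub>0\<^sub>3 = - S\<^sub>1\<^sub>2\<close>, \<open>S\<^sub>2\<^sub>3 = b\<^sub>2 S\<^sub>1\<^sub>2\<close>, where
  \<open>S\<^sub>1\<^sub>2\<close> is a constant with \<open>(b\<^sub>1 - b\<^sub>2') S\<^sub>1\<^sub>2 = 0\<close> (\<open>kernel_jets\<close>). So the kernel is at most a
  line, it contains no nonzero decomposable bivector because
  \<open>S\<^sub>0\<^sub>1 S\<^sub>2\<^sub>3 - S\<^sub>0\<^sub>2 S\<^sub>1\<^sub>3 + S\<^sub>0\<^sub>3 S\<^sub>1\<^sub>2 = - S\<^sub>1\<^sub>2\<^sup>2\<close>, and it vanishes unless \<open>b\<^sub>1 = b\<^sub>2'\<close>.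
  Conversely, if \<open>b\<^sub>1 = b\<^sub>2'\<close>, then \<open>S\<^sub>0\<^sub>1\<close>, \<open>S\<^sub>0\<^sub>2\<close>, \<open>S\<^sub>1\<^sub>2 + S\<^sub>0\<^sub>3\<close>, \<open>S\<^sub>1\<^sub>3\<close> and
  \<open>S\<^sub>2\<^sub>3 - b\<^sub>2 S\<^sub>1\<^sub>2\<close> solve a homogeneous linear system, so that \<open>S\<^sub>0\<^sub>1 = 0\<close> as soon as the
  five functions vanish at one point (\<open>kernel_exists\<close>).

  The degree is computed in \<open>degree_1\<close> and \<open>degree_2\<close>. Existence and uniqueness for linear
  differential equations on an arbitrary interval are proved first, since they provide the basis of
  \<open>V\<close>.
\<close>


section \<open>Derivatives and smooth functions on an interval\<close>

definition nondegenerate_interval :: "real set \<Rightarrow> bool" where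
  "nondegenerate_interval I \<longleftrightarrow> is_interval I \<and> interior I \<noteq> {}"

text \<open>This makes derivatives within \<open>I\<close> unique.\<close>
lemma at_within_interval_neq_bot:
  assumes "nondegenerate_interval I" "t \<in> I"
  shows "at t within I \<noteq> bot"
proof -
  have conn: "connected I"
    using assms by (simp add: nondegenerate_interval_def is_interval_connected)
  have "I \<noteq> {t}"
    using assms by (auto simp: nondegenerate_interval_def)
  then have "t islimpt I"
    using connected_imp_perfect[OF conn] assms(2) by blast
  then show ?thesis
    by (simp add: trivial_limit_within)
qed

lemma nderiv_0 [simp]: "nderiv I 0 f = f"
  by (simp add: nderiv_def)

lemma nderiv_Suc: "t \<in> I \<Longrightarrow> nderiv I (Suc k) f t = vector_derivative (nderiv I k f) (at t within I)"
  by (simp add: nderiv_def)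

lemma nderiv_nderiv: "nderiv I j (nderiv I k f) = nderiv I (j + k) f"
  by (simp add: nderiv_def funpow_add)

lemma smooth_on_nderiv: "smooth_on I f \<Longrightarrow> smooth_on I (nderiv I k f)"
  by (simp add: smooth_on_def nderiv_nderiv)

lemma smooth_on_deriv:
  "smooth_on I f \<Longrightarrow> t \<in> I \<Longrightarrow>
    (nderiv I k f has_vector_derivative nderiv I (Suc k) f t) (at t within I)"
  by (simp add: smooth_on_def nderiv_Suc vector_derivative_works)

lemma smooth_on_deriv0:
  "smooth_on I f \<Longrightarrow> t \<in> I \<Longrightarrow> (f has_vector_derivative nderiv I 1 f t) (at t within I)"
  using smooth_on_deriv[of I f t 0] by simp

lemma nderiv_continuous_on: "smooth_on I f \<Longrightarrow> continuous_on I (nderiv I k f)"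
  using smooth_on_deriv continuous_on_eq_continuous_within has_vector_derivative_continuous by blast

lemma smooth_on_continuous_on: "smooth_on I f \<Longrightarrow> continuous_on I f"
  using nderiv_continuous_on[of I f 0] by simp

locale interval =
  fixes I :: "real set"
  assumes nondegenerate: "nondegenerate_interval I"
begin

lemma vector_derivative_eq:
  "t \<in> I \<Longrightarrow> (f has_vector_derivative d) (at t within I) \<Longrightarrow> vector_derivative f (at t within I) = d"
  using at_within_interval_neq_bot[OF nondegenerate] vector_derivative_within by blast

text \<open>Exhibiting a tower of functions, each the derivative
  of the one before, computes iterated derivatives without unfolding the iteration.\<close>

lemma nderiv_eqI:
  assumes "\<And>t. t \<in> I \<Longrightarrow> F 0 t = f t"
    and "\<And>j t. j < n \<Longrightarrow> t \<in> I \<Longrightarrow> (F j has_vector_derivative F (Suc j) t) (at t within I)"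
  shows "k \<le> n \<Longrightarrow> t \<in> I \<Longrightarrow> nderiv I k f t = F k t"
proof (induction k arbitrary: t)
  case 0
  then show ?case using assms(1) by simp
next
  case (Suc k)
  have "(F k has_vector_derivative F (Suc k) t) (at t within I)"
    using Suc.prems by (intro assms(2)) auto
  then have "(nderiv I k f has_vector_derivative F (Suc k) t) (at t within I)"
    using Suc.prems by (elim has_vector_derivative_transform[rotated 2]) (auto simp: Suc.IH)
  then show ?case
    using Suc.prems by (simp add: nderiv_Suc vector_derivative_eq)
qed

lemma smooth_on_tower:
  assumes F0: "\<And>t. t \<in> I \<Longrightarrow> F 0 t = f t"
    and F: "\<And>j t. t \<in> I \<Longrightarrow> (F j has_vector_derivative F (Suc j) t) (at t within I)"
  shows "smooth_on I f"
  unfolding smooth_on_def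
proof (intro allI ballI)
  fix k t assume t: "t \<in> I"
  have "(nderiv I k f has_vector_derivative F (Suc k) t) (at t within I)"
    using F[OF t, of k]
    by (rule has_vector_derivative_transform[OF t, rotated]) (rule nderiv_eqI[of F, OF F0 F order.refl])
  then show "nderiv I k f differentiable at t within I"
    by (rule differentiableI_vector)
qed

lemma nderiv_cong:
  assumes "\<And>t. t \<in> I \<Longrightarrow> f t = g t" "t \<in> I"
  shows "nderiv I k f t = nderiv I k g t"
  using assms(2)
proof (induction k arbitrary: t)
  case 0
  then show ?case using assms(1) by simp
next
  case (Suc k)
  have "(nderiv I k f has_vector_derivative d) (at t within I) \<longleftrightarrow>
        (nderiv I k g has_vector_derivative d) (at t within I)" for d
    using Suc.IH has_vector_derivative_transform[OF Suc.prems] by metis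
  then show ?case
    using Suc.prems by (simp add: nderiv_Suc vector_derivative_def)
qed

lemma smooth_on_cong:
  assumes "\<And>t. t \<in> I \<Longrightarrow> f t = g t" "smooth_on I g"
  shows "smooth_on I f"
  by (rule smooth_on_tower[where F = "\<lambda>k. nderiv I k g"])
    (use assms smooth_on_deriv in auto)

text \<open>A coinduction principle: if each member of \<open>G\<close> has a derivative that is a polynomial
  expression in members of \<open>G\<close>, then all polynomial expressions in members of \<open>G\<close> are smooth.
  It serves for products, for reciprocals and exponentials, and for solutions of
  differential equations.\<close>

inductive_set poly_closure :: "(real \<Rightarrow> complex) set \<Rightarrow> (real \<Rightarrow> complex) set"
  for G :: "(real \<Rightarrow> complex) set" where
  base: "f \<in> G \<Longrightarrow> f \<in> poly_closure G"
| add: "f \<in> poly_closure G \<Longrightarrow> g \<in> poly_closure G \<Longrightarrow> (\<lambda>t. f t + g t) \<in> poly_closure G"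
| mult: "f \<in> poly_closure G \<Longrightarrow> g \<in> poly_closure G \<Longrightarrow> (\<lambda>t. f t * g t) \<in> poly_closure G"

lemma smooth_on_poly_closure:
  assumes G: "\<And>g. g \<in> G \<Longrightarrow> \<exists>d \<in> poly_closure G. \<forall>t\<in>I. (g has_vector_derivative d t) (at t within I)"
    and f: "f \<in> poly_closure G"
  shows "smooth_on I f"
proof -
  have deriv: "\<exists>d \<in> poly_closure G. \<forall>t\<in>I. (f has_vector_derivative d t) (at t within I)"
    if "f \<in> poly_closure G" for f
    using that
  proof induction
    case (base f)
    then show ?case using G by blast
  next
    case (add f g)
    then obtain d e where "d \<in> poly_closure G" "e \<in> poly_closure G"
      "\<forall>t\<in>I. (f has_vector_derivative d t) (at t within I)"
      "\<forall>t\<in>I. (g has_vector_derivative e t) (at t within I)"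
      by blast
    then show ?case
      by (intro bexI[of _ "\<lambda>t. d t + e t"]) (auto intro: has_vector_derivative_add poly_closure.add)
  next
    case (mult f g)
    then obtain d e where "d \<in> poly_closure G" "e \<in> poly_closure G"
      "\<forall>t\<in>I. (f has_vector_derivative d t) (at t within I)"
      "\<forall>t\<in>I. (g has_vector_derivative e t) (at t within I)"
      by blast
    with mult show ?case
      by (intro bexI[of _ "\<lambda>t. f t * e t + d t * g t"])
        (auto intro: has_vector_derivative_mult poly_closure.add poly_closure.mult)
  qed
  then obtain D where D: "\<And>f. f \<in> poly_closure G \<Longrightarrow> D f \<in> poly_closure G"
    "\<And>f t. f \<in> poly_closure G \<Longrightarrow> t \<in> I \<Longrightarrow> (f has_vector_derivative D f t) (at t within I)"
    by metis
  have mem: "(D ^^ k) f \<in> poly_closure G" for k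
    using f by (induction k) (auto intro: D)
  have step: "((D ^^ k) f has_vector_derivative (D ^^ Suc k) f t) (at t within I)" if "t \<in> I" for k t
    using D(2)[OF mem that] by simp
  show ?thesis
    by (rule smooth_on_tower[where F = "\<lambda>k. (D ^^ k) f"]) (use step in auto)
qed

text \<open>The form in which the principle is applied: smooth functions are admitted as coefficients.\<close>
lemma poly_closure_smooth:
  assumes "\<And>g. g \<in> G \<Longrightarrow> \<exists>d \<in> poly_closure ({f. smooth_on I f} \<union> G).
      \<forall>t\<in>I. (g has_vector_derivative d t) (at t within I)"
    and "f \<in> poly_closure ({f. smooth_on I f} \<union> G)"
  shows "smooth_on I f"
  using _ assms(2)
proof (rule smooth_on_poly_closure)
  fix g assume "g \<in> {f. smooth_on I f} \<union> G"
  then consider "smooth_on I g" | "g \<in> G" by blast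
  then show "\<exists>d\<in>poly_closure ({f. smooth_on I f} \<union> G).
      \<forall>t\<in>I. (g has_vector_derivative d t) (at t within I)"
  proof cases
    case 1
    then show ?thesis
      using smooth_on_deriv0 smooth_on_nderiv
      by (intro bexI[of _ "nderiv I 1 g"] poly_closure.base) auto
  qed (use assms in blast)
qed

lemma smooth_on_const [intro]: "smooth_on I (\<lambda>_. c)"
  by (rule smooth_on_tower[where F = "\<lambda>k t. if k = 0 then c else 0"])
    (auto intro!: has_vector_derivative_const)

lemma smooth_on_add [intro]: "smooth_on I f \<Longrightarrow> smooth_on I g \<Longrightarrow> smooth_on I (\<lambda>t. f t + g t)"
  by (rule poly_closure_smooth[of "{}"]) (auto intro: poly_closure.intros)

lemma smooth_on_mult [intro]: "smooth_on I f \<Longrightarrow> smooth_on I g \<Longrightarrow> smooth_on I (\<lambda>t. f t * g t)"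
  by (rule poly_closure_smooth[of "{}"]) (auto intro: poly_closure.intros)

lemma smooth_on_sum [intro]:
  "(\<And>i. i \<in> A \<Longrightarrow> smooth_on I (f i)) \<Longrightarrow> smooth_on I (\<lambda>t. \<Sum>i\<in>A. f i t)"
  by (induction A rule: infinite_finite_induct) auto

lemma smooth_on_exp:
  assumes "smooth_on I a" "\<And>t. t \<in> I \<Longrightarrow> (h has_vector_derivative a t) (at t within I)"
  shows "smooth_on I (\<lambda>t. exp (h t))"
proof (rule poly_closure_smooth[of "{\<lambda>t. exp (h t)}"])
  fix g assume "g \<in> {\<lambda>t. exp (h t)}"
  then show "\<exists>d\<in>poly_closure ({f. smooth_on I f} \<union> {\<lambda>t. exp (h t)}).
          \<forall>t\<in>I. (g has_vector_derivative d t) (at t within I)"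
    using assms field_vector_diff_chain_within[OF assms(2) has_field_derivative_at_within[OF DERIV_exp]]
    by (intro bexI[of _ "\<lambda>t. a t * exp (h t)"] poly_closure.mult poly_closure.base)
       (auto simp: o_def)
qed (auto intro: poly_closure.base)

lemma smooth_on_inverse:
  assumes "smooth_on I f" "\<And>t. t \<in> I \<Longrightarrow> f t \<noteq> 0"
  shows "smooth_on I (\<lambda>t. inverse (f t))"
proof (rule poly_closure_smooth[of "{\<lambda>t. inverse (f t)}"])
  fix g assume g: "g \<in> {\<lambda>t. inverse (f t)}"
  let ?d = "\<lambda>t. ((-1) * nderiv I 1 f t) * (inverse (f t) * inverse (f t))"
  have "(g has_vector_derivative ?d t) (at t within I)" if "t \<in> I" for t
    using field_vector_diff_chain_within[OF smooth_on_deriv0[OF assms(1) that]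
        has_field_derivative_at_within[OF DERIV_inverse[OF assms(2)[OF that]]]] g
    by (simp add: o_def power2_eq_square)
  moreover have "smooth_on I (\<lambda>t. (-1) * nderiv I 1 f t)"
    by (intro smooth_on_mult smooth_on_const smooth_on_nderiv assms)
  ultimately show "\<exists>d\<in>poly_closure ({f. smooth_on I f} \<union> {\<lambda>t. inverse (f t)}).
          \<forall>t\<in>I. (g has_vector_derivative d t) (at t within I)"
    by (intro bexI[of _ ?d] poly_closure.mult poly_closure.base) (simp_all del: mult_minus1)
qed (auto intro: poly_closure.base)

lemma nderiv_add:
  assumes "smooth_on I f" "smooth_on I g" "t \<in> I"
  shows "nderiv I k (\<lambda>t. f t + g t) t = nderiv I k f t + nderiv I k g t"
  by (rule nderiv_eqI[where F = "\<lambda>k t. nderiv I k f t + nderiv I k g t" and n = k])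
    (use assms in \<open>auto intro!: has_vector_derivative_add smooth_on_deriv\<close>)

lemma nderiv_scale:
  assumes "smooth_on I f" "t \<in> I"
  shows "nderiv I k (\<lambda>t. c * f t) t = c * nderiv I k f t"
  by (rule nderiv_eqI[where F = "\<lambda>k t. c * nderiv I k f t" and n = k])
    (use assms in \<open>auto intro!: has_vector_derivative_mult_right smooth_on_deriv\<close>)

lemma nderiv_sum:
  assumes "\<And>i. i \<in> A \<Longrightarrow> smooth_on I (f i)" "t \<in> I"
  shows "nderiv I k (\<lambda>t. \<Sum>i\<in>A. f i t) t = (\<Sum>i\<in>A. nderiv I k (f i) t)"
  by (rule nderiv_eqI[where F = "\<lambda>k t. \<Sum>i\<in>A. nderiv I k (f i) t" and n = k])
    (use assms in \<open>auto intro!: has_vector_derivative_sum smooth_on_deriv\<close>)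

lemma nderiv_mult:
  assumes "smooth_on I f" "smooth_on I g" "t \<in> I"
  shows "nderiv I n (\<lambda>t. f t * g t) t =
    (\<Sum>k\<le>n. of_nat (n choose k) * nderiv I k f t * nderiv I (n - k) g t)"
  using assms(3)
proof (induction n arbitrary: t)
  case 0
  then show ?case by simp
next
  case (Suc n)
  let ?f = "\<lambda>k. nderiv I k f" and ?g = "\<lambda>k. nderiv I k g"
  have "((\<lambda>t. \<Sum>k\<le>n. of_nat (n choose k) * ?f k t * ?g (n - k) t) has_vector_derivative
      (\<Sum>k\<le>n. of_nat (n choose k) * ?f k t * ?g (Suc (n - k)) t +
        of_nat (n choose k) * ?f (Suc k) t * ?g (n - k) t)) (at t within I)"
    using assms Suc.prems
    by (intro has_vector_derivative_sum has_vector_derivative_mult has_vector_derivative_mult_right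
        smooth_on_deriv) auto
  then have "nderiv I (Suc n) (\<lambda>t. f t * g t) t =
      (\<Sum>k\<le>n. of_nat (n choose k) * ?f k t * ?g (Suc (n - k)) t +
        of_nat (n choose k) * ?f (Suc k) t * ?g (n - k) t)"
    unfolding nderiv_Suc[OF Suc.prems]
    by (intro vector_derivative_eq Suc.prems)
       (erule has_vector_derivative_transform[OF Suc.prems, rotated], simp add: Suc.IH)
  also have "\<dots> = (\<Sum>k\<le>n. of_nat (n choose k) * ?f k t * ?g (Suc n - k) t) +
      (\<Sum>k\<le>n. of_nat (n choose k) * ?f (Suc k) t * ?g (n - k) t)"
    by (simp add: sum.distrib Suc_diff_le)
  also have "(\<Sum>k\<le>n. of_nat (n choose k) * ?f k t * ?g (Suc n - k) t) =
      (\<Sum>k\<le>Suc n. of_nat (n choose k) * ?f k t * ?g (Suc n - k) t)"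
    by (simp add: binomial_eq_0)
  also have "\<dots> = ?f 0 t * ?g (Suc n) t +
      (\<Sum>k\<le>n. of_nat (n choose Suc k) * ?f (Suc k) t * ?g (n - k) t)"
    by (subst sum.atMost_Suc_shift) simp
  also have "\<dots> + (\<Sum>k\<le>n. of_nat (n choose k) * ?f (Suc k) t * ?g (n - k) t) =
     ?f 0 t * ?g (Suc n) t + (\<Sum>k\<le>n. of_nat (Suc n choose Suc k) * ?f (Suc k) t * ?g (n - k) t)"
    by (simp add: sum.distrib[symmetric] algebra_simps)
  also have "\<dots> = (\<Sum>k\<le>Suc n. of_nat (Suc n choose k) * ?f k t * ?g (Suc n - k) t)"
    by (subst sum.atMost_Suc_shift) simp
  finally show ?case .
qed

end


section \<open>Linear differential equations\<close>

context interval begin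

lemma atLeastAtMost_subset: "a \<in> I \<Longrightarrow> b \<in> I \<Longrightarrow> {a..b} \<subseteq> I"
  using nondegenerate mem_is_interval_1_I[of I a b]
  by (simp add: nondegenerate_interval_def subset_eq)

text \<open>\<open>I\<close> may be unbounded or contain an end point. All estimates are made on compact
  subintervals, which have to be neighbourhoods of \<open>t\<close> relative to \<open>I\<close> so that the
  derivatives at \<open>t\<close>, possibly one-sided, are the same.\<close>
lemma compact_neighbourhood:
  assumes s: "s \<in> I" and t: "t \<in> I"
  obtains c d where "c \<in> I" "d \<in> I" "s \<in> {c..d}" "t \<in> {c..d}" "at t within I = at t within {c..d}"
proof -
  obtain d where d: "d \<in> I" "s \<le> d" "t \<le> d" "t < d \<or> (\<forall>u\<in>I. u \<le> t)"
  proof (cases "\<exists>u\<in>I. t < u")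
    case True
    then obtain u where "u \<in> I" "t < u" by blast
    with s t show ?thesis by (intro that[of "max s u"]) (auto simp: max_def)
  next
    case False
    with s t show ?thesis by (intro that[of t]) (auto simp: not_less)
  qed
  obtain c where c: "c \<in> I" "c \<le> s" "c \<le> t" "c < t \<or> (\<forall>u\<in>I. t \<le> u)"
  proof (cases "\<exists>u\<in>I. u < t")
    case True
    then obtain u where "u \<in> I" "u < t" by blast
    with s t show ?thesis by (intro that[of "min s u"]) (auto simp: min_def)
  next
    case False
    with s t show ?thesis by (intro that[of t]) (auto simp: not_less)
  qed
  define c' d' where "c' = (if c < t then c else t - 1)" and "d' = (if t < d then d else t + 1)"
  have "at t within I = at t within {c..d}"
  proof (rule at_within_nhd[of t "{c'<..<d'}"])
    have "c \<le> u" if "u \<in> I" "c' < u" for u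
      using c(3,4) that by (cases "c < t") (auto simp: c'_def)
    moreover have "u \<le> d" if "u \<in> I" "u < d'" for u
      using d(3,4) that by (cases "t < d") (auto simp: d'_def)
    ultimately show "I \<inter> {c'<..<d'} - {t} = {c..d} \<inter> {c'<..<d'} - {t}"
      using atLeastAtMost_subset[OF c(1) d(1)] by auto
  qed (simp_all add: c'_def d'_def)
  with c d show ?thesis
    by (intro that[of c d]) simp_all
qed

lemma antiderivative_exists:
  fixes f :: "real \<Rightarrow> 'b::banach"
  assumes f: "continuous_on I f" and s: "s \<in> I"
  obtains F where "F s = 0" "\<And>t. t \<in> I \<Longrightarrow> (F has_vector_derivative f t) (at t within I)"
proof -
  define F where "F t = (if s \<le> t then integral {s..t} f else - integral {t..s} f)" for t
  have "(F has_vector_derivative f t) (at t within I)" if t: "t \<in> I" for t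
  proof -
    obtain c d where cd: "c \<in> I" "d \<in> I" "s \<in> {c..d}" "t \<in> {c..d}"
      "at t within I = at t within {c..d}"
      using compact_neighbourhood[OF s t] .
    have cont: "continuous_on {c..d} f"
      using f atLeastAtMost_subset[OF cd(1,2)] continuous_on_subset by blast
    have F_eq: "F u = integral {c..u} f - integral {c..s} f" if u: "u \<in> {c..d}" for u
    proof -
      have int: "f integrable_on {a..b}" if "a \<in> {c..d}" "b \<in> {c..d}" for a b
        using that by (intro integrable_continuous_real continuous_on_subset[OF cont]) auto
      show ?thesis
        using u cd(3) Henstock_Kurzweil_Integration.integral_combine[of c s u f]
          Henstock_Kurzweil_Integration.integral_combine[of c u s f] int[of c u] int[of c s]
        by (auto simp: F_def algebra_simps)
    qed
    have "((\<lambda>u. integral {c..u} f - integral {c..s} f) has_vector_derivative f t) (at t within {c..d})"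
      using has_vector_derivative_diff[OF integral_has_vector_derivative[OF cont cd(4)]
          has_vector_derivative_const] by simp
    then have "(F has_vector_derivative f t) (at t within {c..d})"
      by (rule has_vector_derivative_transform[OF cd(4), rotated]) (simp add: F_eq)
    then show ?thesis by (simp add: cd(5))
  qed
  then show ?thesis
    using that[of F] by (simp add: F_def)
qed

text \<open>The exponential weight pays for the factor \<open>M\<close>: integrating
  \<open>M K exp (M|u - s|)\<close> from \<open>s\<close> gives at most \<open>K exp (M|t - s|)\<close>, on either side of \<open>s\<close>.\<close>
lemma norm_le_of_derivative_le:
  fixes f :: "real \<Rightarrow> 'b::banach"
  assumes f: "\<And>u. u \<in> {c..d} \<Longrightarrow> (f has_vector_derivative f' u) (at u within {c..d})"
    and s: "s \<in> {c..d}" "f s = 0" and t: "t \<in> {c..d}" and M: "M > 0" and K: "K \<ge> 0"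
    and le: "\<And>u. u \<in> {c..d} \<Longrightarrow> norm (f' u) \<le> M * K * exp (M * \<bar>u - s\<bar>)"
  shows "norm (f t) \<le> K * exp (M * \<bar>t - s\<bar>)"
proof -
  have deriv: "(f has_vector_derivative f' u) (at u)" if "c < u" "u < d" for u
    using f[of u] that by (simp add: at_within_Icc_at)
  have cont: "continuous_on {c..d} f"
    using f continuous_on_eq_continuous_within has_vector_derivative_continuous by blast
  consider "t = s" | "s < t" | "t < s" by linarith
  then show ?thesis
  proof cases
    case 1
    then show ?thesis using s K by simp
  next
    case 2
    have "norm (f t - f s) \<le> K * exp (M * (t - s)) - K * exp (M * (s - s))"
    proof (rule differentiable_bound_general[OF 2, where f' = f'])
      fix u assume u: "s < u" "u < t"
      show "(f has_vector_derivative f' u) (at u)" using deriv[of u] u s t by simp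
      show "((\<lambda>u. K * exp (M * (u - s))) has_vector_derivative K * (exp (M * (u - s)) * M)) (at u)"
        unfolding has_real_derivative_iff_has_vector_derivative[symmetric]
        by (auto intro!: derivative_eq_intros)
      show "norm (f' u) \<le> K * (exp (M * (u - s)) * M)"
        using le[of u] u s t by (simp add: mult_ac)
    qed (use s t in \<open>auto intro!: continuous_intros continuous_on_subset[OF cont]\<close>)
    with 2 s K show ?thesis by simp
  next
    case 3
    have "norm (f s - f t) \<le> - K * exp (M * (s - s)) - (- K * exp (M * (s - t)))"
    proof (rule differentiable_bound_general[OF 3, where f' = f' and \<phi> = "\<lambda>u. - K * exp (M * (s - u))"])
      fix u assume u: "t < u" "u < s"
      show "(f has_vector_derivative f' u) (at u)" using deriv[of u] u s t by simp
      show "((\<lambda>u. - K * exp (M * (s - u))) has_vector_derivative K * (exp (M * (s - u)) * M)) (at u)"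
        unfolding has_real_derivative_iff_has_vector_derivative[symmetric]
        by (auto intro!: derivative_eq_intros)
      show "norm (f' u) \<le> K * (exp (M * (s - u)) * M)"
        using le[of u] u s t by (simp add: mult_ac)
    qed (use s t in \<open>auto intro!: continuous_intros continuous_on_subset[OF cont]\<close>)
    with 3 s K show ?thesis by simp
  qed
qed

end

locale linear_system = interval +
  fixes A :: "real \<Rightarrow> 'b::euclidean_space \<Rightarrow> 'b"
  assumes linear: "\<And>t. linear (A t)"
    and continuous_apply: "\<And>x. continuous_on I x \<Longrightarrow> continuous_on I (\<lambda>t. A t (x t))"
begin

lemma uniform_bound:
  assumes "c \<in> I" "d \<in> I"
  obtains M where "M > 0" "\<And>t v. t \<in> {c..d} \<Longrightarrow> norm (A t v) \<le> M * norm v"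
proof -
  have "\<exists>B. \<forall>t\<in>{c..d}. norm (A t b) \<le> B" for b
  proof -
    have "compact ((\<lambda>t. A t b) ` {c..d})"
      using continuous_apply[of "\<lambda>_. b"] atLeastAtMost_subset[OF assms]
      by (intro compact_continuous_image) (auto intro: continuous_on_subset)
    then have "bounded ((\<lambda>t. A t b) ` {c..d})"
      by (rule compact_imp_bounded)
    then show ?thesis
      by (auto simp: bounded_iff)
  qed
  then obtain B where B: "\<And>b t. t \<in> {c..d} \<Longrightarrow> norm (A t b) \<le> B b"
    by metis
  have "norm (A t v) \<le> (1 + (\<Sum>b\<in>Basis. \<bar>B b\<bar>)) * norm v" if t: "t \<in> {c..d}" for t v
  proof -
    interpret linear "A t" by (rule linear)
    have "A t v = A t (\<Sum>b\<in>Basis. (v \<bullet> b) *\<^sub>R b)"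
      by (simp add: euclidean_representation)
    also have "\<dots> = (\<Sum>b\<in>Basis. (v \<bullet> b) *\<^sub>R A t b)"
      by (simp add: sum scaleR)
    also have "norm \<dots> \<le> (\<Sum>b\<in>Basis. norm v * \<bar>B b\<bar>)"
    proof (rule sum_norm_le)
      fix b :: 'b assume b: "b \<in> Basis"
      have "norm (A t b) \<le> \<bar>B b\<bar>"
        using B[OF t, of b] by linarith
      then show "norm ((v \<bullet> b) *\<^sub>R A t b) \<le> norm v * \<bar>B b\<bar>"
        using Basis_le_norm[OF b, of v] by (auto intro: mult_mono)
    qed
    also have "\<dots> \<le> (1 + (\<Sum>b\<in>Basis. \<bar>B b\<bar>)) * norm v"
      by (simp add: sum_distrib_left algebra_simps)
    finally show ?thesis .
  qed
  moreover have "1 + (\<Sum>b\<in>Basis. \<bar>B b\<bar>) > 0"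
    by (simp add: add_pos_nonneg sum_nonneg)
  ultimately show ?thesis using that by blast
qed

text \<open>Each integration of a bound \<open>K exp (2M|t - s|)\<close> against an operator of norm at most
  \<open>M\<close> halves the constant. This one estimate gives uniqueness, by iterating it on a
  solution, and existence, by iterating it on the successive approximations.\<close>

lemma halving:
  assumes cd: "c \<in> I" "d \<in> I" "s \<in> {c..d}" and M: "M > 0" "\<And>t v. t \<in> {c..d} \<Longrightarrow> norm (A t v) \<le> M * norm v"
    and y: "\<And>t. t \<in> I \<Longrightarrow> (y has_vector_derivative A t (x t)) (at t within I)" "y s = 0"
    and x: "\<And>t. t \<in> {c..d} \<Longrightarrow> norm (x t) \<le> K * exp (2 * M * \<bar>t - s\<bar>)" and K: "K \<ge> 0"
    and t: "t \<in> {c..d}"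
  shows "norm (y t) \<le> K / 2 * exp (2 * M * \<bar>t - s\<bar>)"
proof (rule norm_le_of_derivative_le[where f' = "\<lambda>t. A t (x t)" and c = c and d = d])
  fix u assume u: "u \<in> {c..d}"
  then show "(y has_vector_derivative A u (x u)) (at u within {c..d})"
    using y(1)[of u] atLeastAtMost_subset[OF cd(1,2)] has_vector_derivative_within_subset by blast
  have "norm (A u (x u)) \<le> M * (K * exp (2 * M * \<bar>u - s\<bar>))"
    using M(2)[OF u, of "x u"] x[OF u] M(1) by (meson mult_left_mono less_imp_le order_trans)
  then show "norm (A u (x u)) \<le> 2 * M * (K / 2) * exp (2 * M * \<bar>u - s\<bar>)"
    by simp
qed (use assms in auto)

lemma zero_solution_unique:
  assumes x: "\<And>t. t \<in> I \<Longrightarrow> (x has_vector_derivative A t (x t)) (at t within I)"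
    and s: "s \<in> I" "x s = 0" and t: "t \<in> I"
  shows "x t = 0"
proof -
  obtain c d where cd: "c \<in> I" "d \<in> I" "s \<in> {c..d}" "t \<in> {c..d}"
    using compact_neighbourhood[OF s(1) t] .
  obtain M where M: "M > 0" "\<And>u v. u \<in> {c..d} \<Longrightarrow> norm (A u v) \<le> M * norm v"
    by (rule uniform_bound[OF cd(1,2)]) blast
  have "continuous_on {c..d} x"
    using x atLeastAtMost_subset[OF cd(1,2)] continuous_on_subset
      continuous_on_eq_continuous_within has_vector_derivative_continuous by metis
  then have "bounded (x ` {c..d})"
    by (intro compact_imp_bounded compact_continuous_image) auto
  then obtain K where K: "K > 0" "\<And>u. u \<in> {c..d} \<Longrightarrow> norm (x u) \<le> K"
    by (auto simp: bounded_pos)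
  have iter: "norm (x u) \<le> K / 2 ^ n * exp (2 * M * \<bar>u - s\<bar>)" if "u \<in> {c..d}" for u n
    using that
  proof (induction n arbitrary: u)
    case 0
    have "1 \<le> exp (2 * M * \<bar>u - s\<bar>)" using M by simp
    then have "K * 1 \<le> K * exp (2 * M * \<bar>u - s\<bar>)"
      using K(1) by (intro mult_left_mono) auto
    then show ?case
      using K(2)[OF 0] by simp
  next
    case (Suc n)
    show ?case
      using halving[OF cd(1-3) M x s(2) Suc.IH _ Suc.prems] K(1) by simp
  qed
  have "(\<lambda>n. K * exp (2 * M * \<bar>t - s\<bar>) * (1 / 2) ^ n) \<longlonglongrightarrow> K * exp (2 * M * \<bar>t - s\<bar>) * 0"
    by (intro tendsto_mult tendsto_const LIMSEQ_power_zero) auto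
  then have "norm (x t) \<le> 0"
    by (intro LIMSEQ_le_const) (use iter[OF cd(4)] in \<open>auto simp: power_divide mult_ac\<close>)
  then show ?thesis by simp
qed

text \<open>Picard iteration. The \<open>n\<close>-th term \<open>p n\<close> is the \<open>n\<close>-fold iterated integral of the initial
  value, so the series of derivatives is \<open>A\<close> applied to the series itself. By the halving
  estimate the series converges uniformly, dominated by a geometric series, on each compact
  subinterval. The sum is defined on all of \<open>I\<close> from the start, hence no gluing is needed.\<close>
theorem solution_exists:
  assumes s: "s \<in> I"
  obtains x where "x s = v" "\<And>t. t \<in> I \<Longrightarrow> (x has_vector_derivative A t (x t)) (at t within I)"
proof -
  have "\<exists>z. continuous_on I y \<longrightarrow> continuous_on I z \<and> z s = 0 \<and>
      (\<forall>t\<in>I. (z has_vector_derivative A t (y t)) (at t within I))" for y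
  proof (cases "continuous_on I y")
    case True
    then obtain z where "z s = 0" "\<And>t. t \<in> I \<Longrightarrow> (z has_vector_derivative A t (y t)) (at t within I)"
      using antiderivative_exists[OF continuous_apply s] by blast
    then show ?thesis
      using continuous_on_eq_continuous_within has_vector_derivative_continuous by blast
  qed simp
  then obtain N where N: "\<And>y. continuous_on I y \<Longrightarrow> continuous_on I (N y)"
    "\<And>y. continuous_on I y \<Longrightarrow> N y s = 0"
    "\<And>y t. continuous_on I y \<Longrightarrow> t \<in> I \<Longrightarrow> (N y has_vector_derivative A t (y t)) (at t within I)"
    by metis
  define p where "p n = (N ^^ n) (\<lambda>_. v)" for n
  have p_cont: "continuous_on I (p n)" for n
    by (induction n) (auto simp: p_def N)
  define p' where "p' n t = (case n of 0 \<Rightarrow> 0 | Suc m \<Rightarrow> A t (p m t))" for n t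
  have p_deriv: "(p n has_vector_derivative p' n t) (at t within I)" if "t \<in> I" for n t
  proof (cases n)
    case 0
    then show ?thesis by (simp add: p_def p'_def has_vector_derivative_const)
  next
    case (Suc m)
    then show ?thesis using N(3)[OF p_cont[of m] that] by (simp add: p_def p'_def)
  qed
  have p_init: "p n s = (if n = 0 then v else 0)" for n
    using N(2)[OF p_cont[of "n - 1"]] by (cases n) (auto simp: p_def)
  \<comment> \<open>Differentiation of the series is a local matter, done near one point \<open>t\<close> at a time.\<close>
  have *: "summable (\<lambda>n. p n t) \<and>
      ((\<lambda>u. \<Sum>n. p n u) has_vector_derivative A t (\<Sum>n. p n t)) (at t within I)"
    if t: "t \<in> I" for t
  proof -
    obtain c d where cd: "c \<in> I" "d \<in> I" "s \<in> {c..d}" "t \<in> {c..d}"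
      and at: "at t within I = at t within {c..d}"
      using compact_neighbourhood[OF s t] .
    note sub = atLeastAtMost_subset[OF cd(1,2)]
    obtain M where M: "M > 0" "\<And>u v. u \<in> {c..d} \<Longrightarrow> norm (A u v) \<le> M * norm v"
      by (rule uniform_bound[OF cd(1,2)]) blast
    have iter: "norm (p n u) \<le> norm v / 2 ^ n * exp (2 * M * \<bar>u - s\<bar>)" if "u \<in> {c..d}" for u n
      using that
    proof (induction n arbitrary: u)
      case 0
      have "1 \<le> exp (2 * M * \<bar>u - s\<bar>)" using M by simp
      then show ?case
        using mult_left_mono[of 1 "exp (2 * M * \<bar>u - s\<bar>)" "norm v"] by (simp add: p_def)
    next
      case (Suc n)
      show ?case
        using halving[OF cd(1-3) M _ _ Suc.IH _ Suc.prems, of "p (Suc n)"]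
          p_deriv[of _ "Suc n"] p_init[of "Suc n"]
        by (simp add: p'_def)
    qed
    define C where "C = norm v * exp (2 * M * (d - c))"
    have le: "norm (p n u) \<le> C * (1 / 2) ^ n" if "u \<in> {c..d}" for u n
    proof -
      have "exp (2 * M * \<bar>u - s\<bar>) \<le> exp (2 * M * (d - c))"
        using that cd M(1) by auto
      then have "norm v / 2 ^ n * exp (2 * M * \<bar>u - s\<bar>) \<le> norm v / 2 ^ n * exp (2 * M * (d - c))"
        by (intro mult_left_mono) auto
      with iter[OF that, of n] show ?thesis
        by (simp add: C_def power_divide mult_ac)
    qed
    have unif: "uniform_limit {c..d} (\<lambda>n u. \<Sum>i<n. p i u) (\<lambda>u. \<Sum>n. p n u) sequentially"
      by (rule Weierstrass_m_test[OF le]) (auto intro: summable_mult summable_geometric)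
    have sums: "(\<lambda>n. p n u) sums (\<Sum>n. p n u)" if "u \<in> {c..d}" for u
      using tendsto_uniform_limitI[OF unif that] by (simp add: sums_def)
    have "\<exists>g. \<forall>u\<in>{c..d}. (\<lambda>n. p n u) sums g u \<and>
        (g has_derivative (\<lambda>h. h *\<^sub>R A u (\<Sum>n. p n u))) (at u within {c..d})"
    proof (rule has_derivative_series[where f' = "\<lambda>n u h. h *\<^sub>R p' n u"])
      show "(p n has_derivative (\<lambda>h. h *\<^sub>R p' n u)) (at u within {c..d})" if "u \<in> {c..d}" for n u
        using has_vector_derivative_within_subset[OF p_deriv sub] that sub
        by (auto simp: has_vector_derivative_def[symmetric])
      fix e :: real assume e: "e > 0"
      have "\<forall>\<^sub>F n in sequentially. \<forall>u\<in>{c..d}. dist (\<Sum>i<n. p i u) (\<Sum>n. p n u) < e / M"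
        using uniform_limitD[OF unif] e M(1) by simp
      then have "\<forall>\<^sub>F n in sequentially. \<forall>u\<in>{c..d}. \<forall>h.
          norm ((\<Sum>i<Suc n. h *\<^sub>R p' i u) - h *\<^sub>R A u (\<Sum>n. p n u)) \<le> e * norm h"
      proof eventually_elim
        case (elim n)
        show ?case
        proof (intro ballI allI)
          fix u h assume u: "u \<in> {c..d}"
          interpret Au: Real_Vector_Spaces.linear "A u" by (rule linear)
          have "(\<Sum>i<Suc n. h *\<^sub>R p' i u) - h *\<^sub>R A u (\<Sum>n. p n u) =
              h *\<^sub>R A u ((\<Sum>i<n. p i u) - (\<Sum>n. p n u))"
            by (subst sum.lessThan_Suc_shift)
              (simp add: p'_def Au.sum Au.diff scaleR_sum_right algebra_simps)
          moreover have "norm (A u ((\<Sum>i<n. p i u) - (\<Sum>n. p n u))) \<le> e"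
          proof -
            have "norm (A u ((\<Sum>i<n. p i u) - (\<Sum>n. p n u))) \<le> M * norm ((\<Sum>i<n. p i u) - (\<Sum>n. p n u))"
              by (rule M(2)[OF u])
            also have "\<dots> \<le> M * (e / M)"
              using elim u M(1) by (intro mult_left_mono) (auto simp: dist_norm intro: less_imp_le)
            finally show ?thesis using M(1) by simp
          qed
          ultimately show "norm ((\<Sum>i<Suc n. h *\<^sub>R p' i u) - h *\<^sub>R A u (\<Sum>n. p n u)) \<le> e * norm h"
            by (simp add: mult.commute[of e] mult_left_mono del: sum.lessThan_Suc)
        qed
      qed
      then show "\<forall>\<^sub>F n in sequentially. \<forall>u\<in>{c..d}. \<forall>h.
          norm ((\<Sum>i<n. h *\<^sub>R p' i u) - h *\<^sub>R A u (\<Sum>n. p n u)) \<le> e * norm h"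
        by (rule eventually_sequentially_Suc[THEN iffD1])
    qed (use sums[OF cd(4)] cd(4) in auto)
    then obtain g where g: "\<And>u. u \<in> {c..d} \<Longrightarrow> (\<lambda>n. p n u) sums g u"
      "(g has_derivative (\<lambda>h. h *\<^sub>R A t (\<Sum>n. p n t))) (at t within {c..d})"
      using cd(4) by blast
    have "((\<lambda>u. \<Sum>n. p n u) has_vector_derivative A t (\<Sum>n. p n t)) (at t within {c..d})"
      using g(2) unfolding has_vector_derivative_def[symmetric]
      by (rule has_vector_derivative_transform[OF cd(4), rotated])
        (use g(1) sums sums_unique2 in blast)
    with sums[OF cd(4)] show ?thesis by (auto simp: at sums_iff)
  qed
  have "(\<Sum>n. p n s) = (\<Sum>n\<in>{0}. p n s)"
    by (rule suminf_finite) (auto simp: p_init)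
  then show ?thesis
    using that[of "\<lambda>t. \<Sum>n. p n t"] * by (simp add: p_init)
qed

end


section \<open>Equivalence, adjoints and the reduced form\<close>

context interval begin

text \<open>Members of \<^const>\<open>Cinf\<close> have to vanish off \<open>I\<close>.\<close>
definition extend_zero :: "(real \<Rightarrow> complex) \<Rightarrow> real \<Rightarrow> complex" where
  "extend_zero f t = (if t \<in> I then f t else 0)"

lemma extend_zero_Cinf: "smooth_on I f \<Longrightarrow> extend_zero f \<in> Cinf I"
  using smooth_on_cong[of "extend_zero f" f] by (auto simp: Cinf_def extend_zero_def)

lemma nderiv_extend_zero: "t \<in> I \<Longrightarrow> nderiv I k (extend_zero f) t = nderiv I k f t"
  by (rule nderiv_cong) (simp_all add: extend_zero_def)

lemma Cinf_smooth: "x \<in> Cinf I \<Longrightarrow> smooth_on I x"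
  by (simp add: Cinf_def)

lemma Cinf_mult: "smooth_on I f \<Longrightarrow> x \<in> Cinf I \<Longrightarrow> (\<lambda>t. f t * x t) \<in> Cinf I"
  by (auto simp: Cinf_def)

text \<open>A multiple of \<open>(t - s)\<^sup>m\<close>. Applying an operator to it isolates one coefficient at \<open>s\<close>.\<close>
lemma test_function:
  assumes s: "s \<in> I"
  obtains x c where "x \<in> Cinf I" "c \<noteq> 0" "\<And>k. nderiv I k x s = (if k = m then c else 0)"
proof -
  \<comment> \<open>The falling factorial, which is zero for \<open>k > m\<close>.\<close>
  define p where "p k = (\<Prod>i<k. of_nat m - of_nat i :: complex)" for k
  define F where "F k t = p k * of_real (t - s) ^ (m - k)" for k and t :: real
  have "(F k has_vector_derivative F (Suc k) t) (at t within I)" for k t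
  proof -
    have p_Suc: "p (Suc k) = p k * (of_nat m - of_nat k)"
      by (simp add: p_def)
    have "p k = 0" if "m < k"
      using that by (auto simp: p_def)
    then have "p (Suc k) = p k * of_nat (m - k)"
      unfolding p_Suc by (cases "m < k") (auto simp: of_nat_diff not_less)
    moreover have "((\<lambda>t. complex_of_real (t - s) ^ (m - k)) has_vector_derivative
        of_nat (m - k) * of_real (t - s) ^ (m - Suc k)) (at t within I)"
    proof -
      have "((\<lambda>t. (t - s) ^ (m - k)) has_real_derivative
          of_nat (m - k) * (t - s) ^ (m - Suc k)) (at t within I)"
        by (auto intro!: derivative_eq_intros)
      from has_vector_derivative_of_real[OF this, where 'a = complex] show ?thesis by simp
    qed
    ultimately show ?thesis
      unfolding F_def using has_vector_derivative_mult_right by (auto simp: mult.assoc)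
  qed
  then have F: "nderiv I k (F 0) t = F k t" and "smooth_on I (F 0)" if "t \<in> I" for k t
    using nderiv_eqI[of F "F 0" k k] smooth_on_tower[of F "F 0"] that by auto
  moreover have "F k s = (if k = m then p m else 0)" for k
  proof (cases k m rule: linorder_cases)
    case greater
    then have "p k = 0" by (auto simp: p_def)
    with greater show ?thesis by (simp add: F_def)
  qed (auto simp: F_def)
  moreover have "p m \<noteq> 0"
    by (simp add: p_def)
  ultimately show ?thesis
    using that[of "extend_zero (F 0)" "p m"] s
    by (simp add: extend_zero_Cinf nderiv_extend_zero)
qed

lemma nderiv_mult_test_function:
  assumes "smooth_on I f" "x \<in> Cinf I" "s \<in> I" "\<And>k. nderiv I k x s = (if k = m then c else 0)"
  shows "nderiv I n (\<lambda>t. f t * x t) s = (if m \<le> n then of_nat (n choose m) * nderiv I (n - m) f s * c else 0)"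
proof -
  have "nderiv I n (\<lambda>t. x t * f t) s =
      (\<Sum>k\<le>n. if k = m then of_nat (n choose k) * c * nderiv I (n - k) f s else 0)"
    unfolding nderiv_mult[OF Cinf_smooth[OF assms(2)] assms(1,3)]
    by (rule sum.cong) (simp_all add: assms(4))
  then show ?thesis
    by (simp add: mult_ac)
qed

text \<open>If the orders differ, the test function of degree equal to the larger order is annihilated
  at \<open>s\<close> by one side of the equivalence and not by the other.\<close>
lemma ldo_equivalent_order:
  assumes equiv: "ldo_equivalent I L M"
  shows "ldo_order M = ldo_order L"
proof (rule ccontr)
  assume neq: "ldo_order M \<noteq> ldo_order L"
  define m where "m = max (ldo_order L) (ldo_order M)"
  obtain \<mu> where \<mu>: "smooth_on I \<mu>" "\<And>t. t \<in> I \<Longrightarrow> \<mu> t \<noteq> 0"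
    "\<And>x t. x \<in> Cinf I \<Longrightarrow> t \<in> I \<Longrightarrow> ldo_apply I M x t = 1 / \<mu> t * ldo_apply I L (\<lambda>s. \<mu> s * x s) t"
    using equiv by (auto simp: ldo_equivalent_def)
  obtain s where s: "s \<in> I"
    using nondegenerate interior_subset by (fastforce simp: nondegenerate_interval_def)
  obtain x c where x: "x \<in> Cinf I" "c \<noteq> 0" "\<And>k. nderiv I k x s = (if k = m then c else 0)"
    using test_function[OF s] by blast
  have "ldo_apply I M x s = (if ldo_order M = m then c else 0)"
    by (auto simp: ldo_apply_def x(3) m_def intro!: sum.neutral)
  moreover have "ldo_apply I L (\<lambda>t. \<mu> t * x t) s = (if ldo_order L = m then \<mu> s * c else 0)"
    by (auto simp: ldo_apply_def nderiv_mult_test_function[OF \<mu>(1) x(1) s x(3)] m_def intro!: sum.neutral)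
  ultimately show False
    using \<mu>(2)[OF s] \<mu>(3)[OF x(1) s] x(2) neq by (auto simp: m_def max_def split: if_splits)
qed

text \<open>By the Leibniz rule, conjugation with \<open>\<mu>\<close> stays within monic operators with smooth
  coefficients, and changes the subleading coefficient by a multiple of \<open>\<mu>' / \<mu>\<close>.\<close>
lemma ldo_conjugate:
  assumes L: "ldo_on I L" and \<mu>: "smooth_on I \<mu>" "\<And>t. t \<in> I \<Longrightarrow> \<mu> t \<noteq> 0"
    and n: "ldo_order L = Suc n"
  obtains M where "ldo_on I M" "ldo_order M = Suc n"
    "\<And>t. t \<in> I \<Longrightarrow> ldo_coeff M n t = ldo_coeff L n t + of_nat (Suc n) * nderiv I 1 \<mu> t / \<mu> t"
    "\<And>x t. x \<in> Cinf I \<Longrightarrow> t \<in> I \<Longrightarrow> ldo_apply I M x t = 1 / \<mu> t * ldo_apply I L (\<lambda>s. \<mu> s * x s) t"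
proof -
  \<comment> \<open>The leading coefficient 1 is included in order to treat all terms uniformly.\<close>
  define a where "a k t = (if k = Suc n then 1 else ldo_coeff L k t)" for k t
  define b where "b j t = inverse (\<mu> t) * (\<Sum>k\<le>Suc n. of_nat (k choose j) * a k t * nderiv I (k - j) \<mu> t)" for j t
  define M where "M = \<lparr>ldo_order = Suc n, ldo_coeff = b\<rparr>"
  have a_smooth: "smooth_on I (a k)" if "k \<le> Suc n" for k
  proof (cases "k = Suc n")
    case True
    then show ?thesis using smooth_on_const[of 1] by (simp add: a_def[abs_def])
  next
    case False
    then show ?thesis using L that n by (simp add: a_def[abs_def] ldo_on_def)
  qed
  have L_apply: "ldo_apply I L y t = (\<Sum>k\<le>Suc n. a k t * nderiv I k y t)" for y t
    by (simp add: ldo_apply_def n a_def lessThan_Suc_atMost)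
  have top: "b (Suc n) t = 1" if "t \<in> I" for t
    using \<mu>(2)[OF that] by (simp add: b_def a_def binomial_eq_0)
  have M_apply: "ldo_apply I M x t = (\<Sum>j\<le>Suc n. b j t * nderiv I j x t)" if "t \<in> I" for x t
    using top[OF that] by (simp add: ldo_apply_def M_def lessThan_Suc_atMost)
  show ?thesis
  proof (rule that[of M])
    show "ldo_on I M"
      unfolding ldo_on_def M_def b_def
      using a_smooth \<mu>
      by (auto intro!: smooth_on_mult smooth_on_inverse smooth_on_sum smooth_on_nderiv simp del: sum.atMost_Suc)
    show "ldo_coeff M n t = ldo_coeff L n t + of_nat (Suc n) * nderiv I 1 \<mu> t / \<mu> t" if "t \<in> I" for t
      using \<mu>(2)[OF that]
      by (cases n) (simp_all add: M_def b_def a_def binomial_eq_0 field_simps)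
    show "ldo_apply I M x t = 1 / \<mu> t * ldo_apply I L (\<lambda>s. \<mu> s * x s) t"
      if x: "x \<in> Cinf I" and t: "t \<in> I" for x t
    proof -
      have "ldo_apply I L (\<lambda>s. x s * \<mu> s) t =
          (\<Sum>k\<le>Suc n. \<Sum>j\<le>k. a k t * (of_nat (k choose j) * nderiv I j x t * nderiv I (k - j) \<mu> t))"
        unfolding L_apply using x \<mu>(1) t
        by (auto simp: nderiv_mult Cinf_def sum_distrib_left intro!: sum.cong)
      also have "\<dots> =
          (\<Sum>k\<le>Suc n. \<Sum>j\<le>Suc n. a k t * (of_nat (k choose j) * nderiv I j x t * nderiv I (k - j) \<mu> t))"
        by (intro sum.cong sum.mono_neutral_left) (auto simp: binomial_eq_0)
      also have "\<dots> =
          (\<Sum>j\<le>Suc n. \<Sum>k\<le>Suc n. a k t * (of_nat (k choose j) * nderiv I j x t * nderiv I (k - j) \<mu> t))"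
        by (rule sum.swap)
      also have "\<dots> = \<mu> t * ldo_apply I M x t"
      proof -
        have "\<mu> t * b j t = (\<Sum>k\<le>Suc n. of_nat (k choose j) * a k t * nderiv I (k - j) \<mu> t)" for j
          unfolding b_def using \<mu>(2)[OF t] by (simp del: sum.atMost_Suc)
        then have "\<mu> t * (b j t * y) = (\<Sum>k\<le>Suc n. a k t * (of_nat (k choose j) * y * nderiv I (k - j) \<mu> t))" for j y
          unfolding mult.assoc[symmetric, of "\<mu> t"] sum_distrib_right
          by (simp only: sum_distrib_right) (simp add: mult_ac del: sum.atMost_Suc)
        then show ?thesis
          unfolding M_apply[OF t] sum_distrib_left by simp
      qed
      finally show ?thesis
        using \<mu>(2)[OF t] by (simp add: mult.commute)
    qed
  qed (simp add: M_def)
qed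

text \<open>The subleading coefficient \<open>a\<close> of an operator of order \<open>n\<close> is removed by the solution
  \<open>\<mu> = exp (- \<integral>a / n)\<close> of \<open>n \<mu>' = - a \<mu>\<close>.\<close>
lemma ldo_reduced_form:
  assumes L: "ldo_on I L" and n: "ldo_order L = Suc n"
  obtains M where "ldo_on I M" "ldo_order M = Suc n" "\<And>t. t \<in> I \<Longrightarrow> ldo_coeff M n t = 0"
    "ldo_equivalent I L M"
proof -
  obtain s where s: "s \<in> I"
    using nondegenerate interior_subset by (fastforce simp: nondegenerate_interval_def)
  let ?a = "\<lambda>t. (- 1 / of_nat (Suc n)) * ldo_coeff L n t"
  have a: "smooth_on I ?a"
    using L n by (intro smooth_on_mult smooth_on_const) (simp add: ldo_on_def)
  obtain h where h: "\<And>t. t \<in> I \<Longrightarrow> (h has_vector_derivative ?a t) (at t within I)"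
    using antiderivative_exists[OF smooth_on_continuous_on[OF a] s] by blast
  let ?\<mu> = "\<lambda>t. exp (h t)"
  have \<mu>: "smooth_on I ?\<mu>"
    by (rule smooth_on_exp[OF a h])
  have "nderiv I 1 ?\<mu> t = ?a t * exp (h t)" if t: "t \<in> I" for t
    using field_vector_diff_chain_within[OF h[OF t] has_field_derivative_at_within[OF DERIV_exp]] t
    by (simp add: nderiv_Suc vector_derivative_eq o_def)
  then have cancel: "ldo_coeff L n t + of_nat (Suc n) * nderiv I 1 ?\<mu> t / ?\<mu> t = 0" if "t \<in> I" for t
    using that by (simp del: of_nat_Suc One_nat_def)
  obtain M where M: "ldo_on I M" "ldo_order M = Suc n"
    "\<And>t. t \<in> I \<Longrightarrow> ldo_coeff M n t = ldo_coeff L n t + of_nat (Suc n) * nderiv I 1 ?\<mu> t / ?\<mu> t"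
    "\<And>x t. x \<in> Cinf I \<Longrightarrow> t \<in> I \<Longrightarrow> ldo_apply I M x t = 1 / ?\<mu> t * ldo_apply I L (\<lambda>s. ?\<mu> s * x s) t"
    by (rule ldo_conjugate[OF L \<mu> exp_not_eq_zero n]) (rule that)
  show ?thesis
  proof (rule that)
    show "ldo_coeff M n t = 0" if "t \<in> I" for t
      using M(3)[OF that] cancel[OF that] by simp
    show "ldo_equivalent I L M"
      unfolding ldo_equivalent_def using \<mu> M(4) by (intro exI[of _ ?\<mu>]) auto
  qed (use M in auto)
qed

lemma lessThan_4: "{..<4::nat} = {0, 1, 2, 3}"
  by auto

text \<open>For the forward direction the two operators are compared on multiples of \<open>(t - s)\<^sup>3\<close> and then
  of \<open>t - s\<close>; the other direction is the Leibniz rule.\<close>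
lemma self_adjoint_order_4_iff:
  assumes M: "ldo_on I M" "ldo_order M = 4"
  shows "ldo_self_adjoint I M \<longleftrightarrow>
    (\<forall>t\<in>I. ldo_coeff M 3 t = 0 \<and> ldo_coeff M 1 t = nderiv I 1 (ldo_coeff M 2) t)"
proof -
  let ?b = "ldo_coeff M"
  have b: "smooth_on I (?b 0)" "smooth_on I (?b 1)" "smooth_on I (?b 2)" "smooth_on I (?b 3)"
    using M by (auto simp: ldo_on_def)
  have L_apply: "ldo_apply I M x t = nderiv I 4 x t + ?b 3 t * nderiv I 3 x t
      + ?b 2 t * nderiv I 2 x t + ?b 1 t * nderiv I 1 x t + ?b 0 t * x t" for x t
    by (simp add: ldo_apply_def M(2) lessThan_4)
  have adj: "adjoint_apply I M x t = nderiv I 4 x t - nderiv I 3 (\<lambda>t. ?b 3 t * x t) t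
      + nderiv I 2 (\<lambda>t. ?b 2 t * x t) t - nderiv I 1 (\<lambda>t. ?b 1 t * x t) t + ?b 0 t * x t" for x t
    by (simp add: adjoint_apply_def M(2) lessThan_4)
  show ?thesis
  proof
    assume sa: "ldo_self_adjoint I M"
    have b3: "?b 3 s = 0" if s: "s \<in> I" for s
    proof -
      obtain x c where x: "x \<in> Cinf I" "c \<noteq> 0" "\<And>k. nderiv I k x s = (if k = 3 then c else 0)"
        using test_function[OF s] by blast
      have "adjoint_apply I M x s = ldo_apply I M x s"
        using sa x(1) s by (simp add: ldo_self_adjoint_def)
      then show ?thesis
        using x(2) x(3)[of 0] by (simp add: L_apply adj x(3) nderiv_mult_test_function[OF _ x(1) s x(3)] b b[unfolded One_nat_def])
    qed
    have "?b 1 s = nderiv I 1 (?b 2) s" if s: "s \<in> I" for s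
    proof -
      obtain x c where x: "x \<in> Cinf I" "c \<noteq> 0" "\<And>k. nderiv I k x s = (if k = 1 then c else 0)"
        using test_function[OF s] by blast
      have "nderiv I k (?b 3) s = 0" for k
        using nderiv_cong[of "?b 3" "\<lambda>_. 0" s k] nderiv_scale[OF b(1) s, of k 0] b3 s by simp
      moreover have "adjoint_apply I M x s = ldo_apply I M x s"
        using sa x(1) s by (simp add: ldo_self_adjoint_def)
      ultimately show ?thesis
        using x(2) x(3)[of 0] by (simp add: L_apply adj x(3) nderiv_mult_test_function[OF _ x(1) s x(3)] b b[unfolded One_nat_def])
    qed
    with b3 show "\<forall>t\<in>I. ?b 3 t = 0 \<and> ?b 1 t = nderiv I 1 (?b 2) t" by blast
  next
    assume *: "\<forall>t\<in>I. ?b 3 t = 0 \<and> ?b 1 t = nderiv I 1 (?b 2) t"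
    show "ldo_self_adjoint I M"
      unfolding ldo_self_adjoint_def
    proof (intro ballI)
      fix x t assume x: "x \<in> Cinf I" and t: "t \<in> I"
      have 3: "nderiv I 3 (\<lambda>t. ?b 3 t * x t) t = 0"
        using nderiv_cong[of "\<lambda>t. ?b 3 t * x t" "\<lambda>_. 0" t 3] nderiv_scale[OF b(1) t, of 3 0] * t by simp
      have 1: "nderiv I 1 (\<lambda>t. ?b 1 t * x t) t = nderiv I 2 (?b 2) t * x t + ?b 1 t * nderiv I 1 x t"
        using nderiv_mult[OF b(2) Cinf_smooth[OF x] t, of 1]
          nderiv_cong[of "?b 1" "nderiv I 1 (?b 2)" t 1] * t
        by (simp add: nderiv_nderiv numeral_2_eq_2)
      have 2: "nderiv I 2 (\<lambda>t. ?b 2 t * x t) t =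
          ?b 2 t * nderiv I 2 x t + 2 * (?b 1 t * nderiv I 1 x t) + nderiv I 2 (?b 2) t * x t"
        using nderiv_mult[OF b(3) Cinf_smooth[OF x] t, of 2] * t
        by (simp add: numeral_2_eq_2 algebra_simps)
      show "adjoint_apply I M x t = ldo_apply I M x t"
        using * t by (simp add: adj L_apply 1 2 3 del: One_nat_def)
    qed
  qed
qed

end


section \<open>Solutions of a reduced operator of order four\<close>

text \<open>The type \<open>4\<close> of four elements indexes a basis of solutions. Its elements are written
  0, 1, 2, 3, so that the basis solution number \<open>k\<close> can be the one whose \<open>k\<close>-th derivative is 1 at
  the initial point while the others vanish.\<close>
lemma UNIV_index: "(UNIV :: 4 set) = {0, 1, 2, 3}"
proof -
  have "(4 :: 4) = 0" by simp
  then show ?thesis unfolding UNIV_4 by auto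
qed

lemma all_index: "(\<forall>k::4. P k) \<longleftrightarrow> P 0 \<and> P 1 \<and> P 2 \<and> P 3"
  using UNIV_index by (metis UNIV_I empty_iff insert_iff)

lemma sum_index: "(\<Sum>k\<in>(UNIV :: 4 set). h k) = h 0 + h 1 + h 2 + h 3"
  unfolding UNIV_index by (simp add: add.assoc)

definition comb :: "(4 \<Rightarrow> real \<Rightarrow> complex) \<Rightarrow> (4 \<Rightarrow> complex) \<Rightarrow> real \<Rightarrow> complex" where
  "comb f a t = (\<Sum>k\<in>UNIV. a k * f k t)"

text \<open>Stated as a vanishing sum, because \<open>p k l = - p l k\<close> is a rewrite rule that loops.\<close>
definition antisymmetric :: "(4 \<Rightarrow> 4 \<Rightarrow> complex) \<Rightarrow> bool" where
  "antisymmetric p \<longleftrightarrow> (\<forall>k l. p k l + p l k = 0)"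

lemma (in interval) nderiv_comb:
  assumes "\<And>k. smooth_on I (f k)" "t \<in> I"
  shows "nderiv I i (comb f a) t = (\<Sum>k\<in>UNIV. a k * nderiv I i (f k) t)"
  unfolding comb_def[abs_def] using assms
  by (subst nderiv_sum) (auto simp: nderiv_scale)

lemma (in interval) comb_Cinf: "(\<And>k. f k \<in> Cinf I) \<Longrightarrow> comb f a \<in> Cinf I"
  unfolding comb_def[abs_def] Cinf_def by (auto intro!: smooth_on_sum smooth_on_mult smooth_on_const)

locale reduced_operator = interval +
  fixes M :: ldo and s :: real
  assumes M: "ldo_on I M" "ldo_order M = 4" and s: "s \<in> I"
    and reduced: "\<And>t. t \<in> I \<Longrightarrow> ldo_coeff M 3 t = 0"
begin

abbreviation b where "b \<equiv> ldo_coeff M"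

lemma b_smooth: "i < 4 \<Longrightarrow> smooth_on I (b i)"
  using M by (simp add: ldo_on_def)

lemma M_apply: "t \<in> I \<Longrightarrow> ldo_apply I M x t =
    nderiv I 4 x t + b 2 t * nderiv I 2 x t + b 1 t * nderiv I 1 x t + b 0 t * x t"
  by (simp add: ldo_apply_def M(2) lessThan_4 reduced)

text \<open>The first-order system for \<open>(x, x', x'', x''')\<close>.\<close>
definition companion :: "real \<Rightarrow> complex \<times> complex \<times> complex \<times> complex \<Rightarrow> complex \<times> complex \<times> complex \<times> complex" where
  "companion t = (\<lambda>(x0, x1, x2, x3). (x1, x2, x3, - (b 0 t * x0 + b 1 t * x1 + b 2 t * x2)))"

lemma linear_system_companion: "linear_system I companion"
proof (intro linear_system.intro linear_system_axioms.intro interval_axioms)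
  show "linear (companion t)" for t
    by (rule linearI) (auto simp: companion_def algebra_simps scaleR_conv_of_real)
  show "continuous_on I (\<lambda>t. companion t (x t))" if "continuous_on I x" for x
    unfolding companion_def case_prod_unfold
    by (intro continuous_intros that smooth_on_continuous_on b_smooth) simp_all
qed

lemma initial_value_solution:
  obtains x where "x \<in> sol_space I M" "x s = v0" "nderiv I 1 x s = v1" "nderiv I 2 x s = v2" "nderiv I 3 x s = v3"
proof -
  interpret linear_system I companion by (rule linear_system_companion)
  obtain X where X: "X s = (v0, v1, v2, v3)"
    "\<And>t. t \<in> I \<Longrightarrow> (X has_vector_derivative companion t (X t)) (at t within I)"
    using solution_exists[OF s] by blast
  \<comment> \<open>The components of \<open>X\<close> form the beginning of the tower of derivatives of the solution;
    the fourth derivative is given by the equation.\<close>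
  define F where "F i t = (if i = 0 then fst (X t) else if i = 1 then fst (snd (X t))
    else if i = 2 then fst (snd (snd (X t))) else if i = 3 then snd (snd (snd (X t)))
    else snd (snd (snd (companion t (X t)))))" for i :: nat and t
  have F: "(F i has_vector_derivative F (Suc i) t) (at t within I)" if "i < 4" "t \<in> I" for i t
  proof -
    have "((\<lambda>t. fst (Y t)) has_vector_derivative fst d) (at t within I)"
      "((\<lambda>t. snd (Y t)) has_vector_derivative snd d) (at t within I)"
      if "(Y has_vector_derivative d) (at t within I)"
      for Y :: "real \<Rightarrow> 'x::real_normed_vector \<times> 'y::real_normed_vector" and d
      using bounded_linear.has_vector_derivative[OF bounded_linear_fst that]
        bounded_linear.has_vector_derivative[OF bounded_linear_snd that] by simp_all
    note proj = this
    note X0 = X(2)[OF that(2)]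
    note X1 = proj(2)[OF X0]
    note X2 = proj(2)[OF X1]
    have "i = 0 \<or> i = 1 \<or> i = 2 \<or> i = 3"
      using that(1) by arith
    then show ?thesis
      using proj(1)[OF X0] proj(1)[OF X1] proj(1)[OF X2] proj(2)[OF X2]
      by (elim disjE) (simp_all add: F_def[abs_def] companion_def case_prod_unfold)
  qed
  \<comment> \<open>The derivatives of the components are polynomials in the components and the coefficients.\<close>
  have sm: "smooth_on I (F i)" if i: "i < 4" for i
  proof (rule poly_closure_smooth)
    show "F i \<in> poly_closure ({f. smooth_on I f} \<union> F ` {..<4})"
      using i by (intro poly_closure.base) auto
    fix h assume "h \<in> F ` {..<4}"
    then obtain j where j: "j < 4" "h = F j" by auto
    have top: "F 4 = (\<lambda>t. (\<lambda>t. - 1 * b 0 t) t * F 0 t + ((\<lambda>t. - 1 * b 1 t) t * F 1 t + (\<lambda>t. - 1 * b 2 t) t * F 2 t))"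
      by (simp add: F_def companion_def case_prod_unfold fun_eq_iff)
    have "F (Suc j) \<in> poly_closure ({f. smooth_on I f} \<union> F ` {..<4})"
    proof (cases "j = 3")
      case True
      have "F 4 \<in> poly_closure ({f. smooth_on I f} \<union> F ` {..<4})"
        unfolding top
        by (intro poly_closure.add poly_closure.mult poly_closure.base UnI1 UnI2 CollectI
            smooth_on_mult smooth_on_const b_smooth imageI) simp_all
      with True show ?thesis by simp
    next
      case False
      with j show ?thesis by (intro poly_closure.base) auto
    qed
    then show "\<exists>d\<in>poly_closure ({f. smooth_on I f} \<union> F ` {..<4}).
        \<forall>t\<in>I. (h has_vector_derivative d t) (at t within I)"
      using F j by blast
  qed
  have D: "nderiv I i (extend_zero (F 0)) t = F i t" if "i \<le> 4" "t \<in> I" for i t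
    unfolding nderiv_extend_zero[OF that(2)]
    by (rule nderiv_eqI[where n = 4]) (use F that in auto)
  show ?thesis
  proof (rule that[of "extend_zero (F 0)"])
    have "ldo_apply I M (extend_zero (F 0)) t = 0" if "t \<in> I" for t
      unfolding M_apply[OF that] using D[of 0 t] that
      by (simp add: D) (simp add: F_def companion_def case_prod_unfold)
    then show "extend_zero (F 0) \<in> sol_space I M"
      using extend_zero_Cinf[OF sm] by (simp add: sol_space_def)
    show "extend_zero (F 0) s = v0" "nderiv I 1 (extend_zero (F 0)) s = v1"
      "nderiv I 2 (extend_zero (F 0)) s = v2" "nderiv I 3 (extend_zero (F 0)) s = v3"
      using D[of 0 s] D[of 1 s] D[of 2 s] D[of 3 s] s X(1) by (auto simp: F_def)
  qed
qed

lemma initial_value_unique: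
  assumes x: "x \<in> sol_space I M"
    and init: "x s = 0" "nderiv I 1 x s = 0" "nderiv I 2 x s = 0" "nderiv I 3 x s = 0"
  shows "x = (\<lambda>_. 0)"
proof
  interpret linear_system I companion by (rule linear_system_companion)
  have sm: "smooth_on I x" and outside: "\<And>t. t \<notin> I \<Longrightarrow> x t = 0"
    using x by (auto simp: sol_space_def Cinf_def)
  define X where "X t = (x t, nderiv I 1 x t, nderiv I 2 x t, nderiv I 3 x t)" for t
  have "(X has_vector_derivative companion t (X t)) (at t within I)" if t: "t \<in> I" for t
  proof -
    have "nderiv I 4 x t = - (b 0 t * x t + b 1 t * nderiv I 1 x t + b 2 t * nderiv I 2 x t)"
      using x t M_apply[OF t, of x] by (simp add: sol_space_def algebra_simps add_eq_0_iff)
    then show ?thesis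
      using smooth_on_deriv[OF sm t, of 0] smooth_on_deriv[OF sm t, of 1]
        smooth_on_deriv[OF sm t, of 2] smooth_on_deriv[OF sm t, of 3]
      unfolding X_def companion_def
      by (auto intro!: has_vector_derivative_Pair simp: eval_nat_numeral)
  qed
  then have "X t = 0" if "t \<in> I" for t
    using zero_solution_unique[of X s t] s that init by (auto simp: X_def zero_prod_def)
  then show "x t = 0" for t
    using outside by (cases "t \<in> I") (auto simp: X_def zero_prod_def)
qed

end


section \<open>Bivectors annihilated by the Wronskian\<close>

locale fundamental_system = reduced_operator +
  fixes g :: "4 \<Rightarrow> real \<Rightarrow> complex"
  assumes g: "\<And>k. g k \<in> sol_space I M"
    and g_init: "\<And>k. g k s = of_bool (k = 0)" "\<And>k. nderiv I 1 (g k) s = of_bool (k = 1)"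
      "\<And>k. nderiv I 2 (g k) s = of_bool (k = 2)" "\<And>k. nderiv I 3 (g k) s = of_bool (k = 3)"

lemma (in reduced_operator) fundamental_system_exists: "\<exists>g. fundamental_system I M s g"
proof -
  have "\<forall>k::4. \<exists>x. x \<in> sol_space I M \<and> x s = of_bool (k = 0) \<and> nderiv I 1 x s = of_bool (k = 1)
      \<and> nderiv I 2 x s = of_bool (k = 2) \<and> nderiv I 3 x s = of_bool (k = 3)"
    by (rule allI, rule initial_value_solution) blast
  from choice[OF this] obtain g :: "4 \<Rightarrow> real \<Rightarrow> complex" where
    "\<forall>k. g k \<in> sol_space I M \<and> g k s = of_bool (k = 0) \<and> nderiv I 1 (g k) s = of_bool (k = 1)
      \<and> nderiv I 2 (g k) s = of_bool (k = 2) \<and> nderiv I 3 (g k) s = of_bool (k = 3)"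
    by blast
  then have "fundamental_system I M s g"
    by unfold_locales auto
  then show ?thesis by blast
qed

context fundamental_system
begin

lemma g_Cinf: "g k \<in> Cinf I"
  using g by (simp add: sol_space_def)

lemma g_smooth: "smooth_on I (g k)"
  using g_Cinf by (rule Cinf_smooth)

lemma g_nderiv_4: "t \<in> I \<Longrightarrow>
    nderiv I 4 (g k) t = - (b 0 t * g k t + b 1 t * nderiv I 1 (g k) t + b 2 t * nderiv I 2 (g k) t)"
  using g[of k] M_apply[of t "g k"] by (simp add: sol_space_def algebra_simps add_eq_0_iff)

lemma comb_init:
  "comb g a s = a 0" "nderiv I 1 (comb g a) s = a 1"
  "nderiv I 2 (comb g a) s = a 2" "nderiv I 3 (comb g a) s = a 3"
proof -
  note [simp del] = One_nat_def
  show "comb g a s = a 0"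
    by (simp add: comb_def g_init of_bool_def if_distrib cong: if_cong)
  show "nderiv I 1 (comb g a) s = a 1" "nderiv I 2 (comb g a) s = a 2" "nderiv I 3 (comb g a) s = a 3"
    by (simp_all add: nderiv_comb[OF g_smooth s] g_init of_bool_def if_distrib cong: if_cong)
qed

lemma comb_eq_0_iff: "comb g a = (\<lambda>_. 0) \<longleftrightarrow> a = (\<lambda>_. 0)"
proof
  assume *: "comb g a = (\<lambda>_. 0)"
  have "nderiv I k (\<lambda>_. 0) s = 0" for k
    using nderiv_scale[OF g_smooth s, of k 0] by simp
  then have "\<forall>k. a k = 0"
    using comb_init[of a] by (simp add: all_index *)
  then show "a = (\<lambda>_. 0)" by auto
qed (simp add: comb_def fun_eq_iff)

lemma sol_space_eq: "sol_space I M = range (comb g)"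
proof (intro equalityI subsetI)
  have lin: "ldo_apply I M (comb g a) t = (\<Sum>k\<in>UNIV. a k * ldo_apply I M (g k) t)" if "t \<in> I" for a t
    unfolding M_apply[OF that]
    by (simp add: nderiv_comb[OF g_smooth that] sum_index comb_def algebra_simps)
  have comb: "comb g a \<in> sol_space I M" for a
    using comb_Cinf[OF g_Cinf] g lin by (simp add: sol_space_def)
  then show "x \<in> range (comb g) \<Longrightarrow> x \<in> sol_space I M" for x
    by auto
  fix x assume x: "x \<in> sol_space I M"
  define a where "a k = (if k = 0 then x s else if k = 1 then nderiv I 1 x s
    else if k = 2 then nderiv I 2 x s else nderiv I 3 x s)" for k :: 4
  define y where "y = (\<lambda>t. x t + (-1) * comb g a t)"
  have sm: "smooth_on I x" "smooth_on I (comb g a)"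
    using x comb[of a] by (auto simp: sol_space_def Cinf_def)
  then have sm': "smooth_on I (\<lambda>t. (-1) * comb g a t)"
    by (intro smooth_on_mult smooth_on_const)
  have D: "nderiv I k y t = nderiv I k x t - nderiv I k (comb g a) t" if "t \<in> I" for k t
    unfolding y_def nderiv_add[OF sm(1) sm' that] nderiv_scale[OF sm(2) that] by simp
  have "ldo_apply I M y t = ldo_apply I M x t - ldo_apply I M (comb g a) t" if "t \<in> I" for t
    unfolding M_apply[OF that] by (simp add: D[OF that]) (simp add: y_def algebra_simps)
  moreover have "y \<in> Cinf I"
    using smooth_on_add[OF sm(1) sm'] x comb[of a] by (auto simp: y_def sol_space_def Cinf_def)
  ultimately have "y \<in> sol_space I M"
    using x comb[of a] by (simp add: sol_space_def)
  moreover have "y s = 0" "nderiv I 1 y s = 0" "nderiv I 2 y s = 0" "nderiv I 3 y s = 0"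
    unfolding D[OF s] comb_init by (simp_all add: a_def y_def comb_init)
  ultimately have "y = (\<lambda>_. 0)"
    by (rule initial_value_unique)
  then have "x = comb g a"
    by (auto simp: y_def fun_eq_iff)
  then show "x \<in> range (comb g)" by blast
qed

text \<open>The value \<open>S\<^sub>i\<^sub>j t\<close> of the bivector \<open>p\<close> on the functionals \<open>x \<mapsto> x\<^sup>(\<^sup>i\<^sup>) t\<close> and \<open>x \<mapsto> x\<^sup>(\<^sup>j\<^sup>) t\<close>.\<close>

definition jet :: "(4 \<Rightarrow> 4 \<Rightarrow> complex) \<Rightarrow> nat \<Rightarrow> nat \<Rightarrow> real \<Rightarrow> complex" where
  "jet p i j t = (\<Sum>k\<in>UNIV. \<Sum>l\<in>UNIV. p k l * nderiv I i (g k) t * nderiv I j (g l) t)"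

lemma jet_antisym:
  assumes "antisymmetric p"
  shows "jet p j i t = - jet p i j t"
proof -
  have "jet p j i t = (\<Sum>l\<in>UNIV. \<Sum>k\<in>UNIV. p k l * nderiv I j (g k) t * nderiv I i (g l) t)"
    unfolding jet_def by (rule sum.swap)
  also have "\<dots> = (\<Sum>l\<in>UNIV. \<Sum>k\<in>UNIV. - (p l k * nderiv I i (g l) t * nderiv I j (g k) t))"
  proof (intro sum.cong refl)
    fix k l
    have "p k l = - p l k"
      using assms unfolding antisymmetric_def eq_neg_iff_add_eq_0 by blast
    then show "p k l * nderiv I j (g k) t * nderiv I i (g l) t = - (p l k * nderiv I i (g l) t * nderiv I j (g k) t)"
      by (subst \<open>p k l = - p l k\<close>) (simp only: mult_ac mult_minus_left mult_minus_right)
  qed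
  finally show ?thesis
    by (simp add: jet_def sum_negf)
qed

lemma jet_diag: "antisymmetric p \<Longrightarrow> jet p i i t = 0"
  using jet_antisym[of p i i t] by simp

lemma jet_deriv:
  assumes "t \<in> I"
  shows "(jet p i j has_vector_derivative jet p (Suc i) j t + jet p i (Suc j) t) (at t within I)"
proof -
  have "(jet p i j has_vector_derivative
      (\<Sum>k\<in>UNIV. \<Sum>l\<in>UNIV. p k l * nderiv I i (g k) t * nderiv I (Suc j) (g l) t
        + p k l * nderiv I (Suc i) (g k) t * nderiv I j (g l) t)) (at t within I)"
    unfolding jet_def[abs_def]
    by (intro has_vector_derivative_sum has_vector_derivative_mult has_vector_derivative_mult_right
        smooth_on_deriv g_smooth assms)
  then show ?thesis
    by (simp add: jet_def sum.distrib add.commute)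
qed

lemma jet_4:
  assumes "t \<in> I"
  shows "jet p 4 j t = - (b 0 t * jet p 0 j t + b 1 t * jet p 1 j t + b 2 t * jet p 2 j t)"
  unfolding jet_def sum_distrib_left sum.distrib[symmetric] sum_negf[symmetric]
  by (intro sum.cong refl) (simp add: g_nderiv_4[OF assms] algebra_simps)

lemma jet_init:
  "jet p 0 1 s = p 0 1" "jet p 0 2 s = p 0 2" "jet p 0 3 s = p 0 3"
  "jet p 1 2 s = p 1 2" "jet p 1 3 s = p 1 3" "jet p 2 3 s = p 2 3"
proof -
  have delta: "(\<Sum>k\<in>UNIV. \<Sum>l\<in>UNIV. p k l * of_bool (k = i) * of_bool (l = j)) = p i j" for i j
  proof -
    have "(\<Sum>k\<in>UNIV. \<Sum>l\<in>UNIV. p k l * of_bool (k = i) * of_bool (l = j)) =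
        (\<Sum>k\<in>UNIV. \<Sum>l\<in>UNIV. if l = j then (if k = i then p k l else 0) else 0)"
      by (intro sum.cong refl) auto
    then show ?thesis by simp
  qed
  note [simp del] = One_nat_def
  show "jet p 0 1 s = p 0 1" "jet p 0 2 s = p 0 2" "jet p 0 3 s = p 0 3"
    "jet p 1 2 s = p 1 2" "jet p 1 3 s = p 1 3" "jet p 2 3 s = p 2 3"
    by (simp_all only: jet_def g_init delta nderiv_0)
qed

lemma jet_deriv_eq:
  assumes "\<And>t. t \<in> I \<Longrightarrow> jet p i j t = f t" "(f has_vector_derivative d) (at t within I)" "t \<in> I"
  shows "jet p (Suc i) j t + jet p i (Suc j) t = d"
proof -
  have h: "(jet p i j has_vector_derivative d) (at t within I)"
    using assms(2) by (rule has_vector_derivative_transform[OF assms(3), rotated]) (rule assms(1))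
  show ?thesis
    using vector_derivative_eq[OF assms(3) h] vector_derivative_eq[OF assms(3) jet_deriv[OF assms(3), of p i j]]
    by simp
qed

lemma jet_deriv_eq_0:
  assumes "\<And>t. t \<in> I \<Longrightarrow> jet p i j t = 0" "t \<in> I"
  shows "jet p (Suc i) j t + jet p i (Suc j) t = 0"
  by (rule jet_deriv_eq[of p i j "\<lambda>_. 0"]) (use assms in auto)

text \<open>The equation \<open>S\<^sub>0\<^sub>1 = 0\<close> is differentiated until it yields nothing new. By antisymmetry
  \<open>S\<^sub>i\<^sub>i = 0\<close>, and an index 4 is eliminated with the differential equation. The values at \<open>s\<close> are
  the entries of \<open>p\<close> itself, because \<open>g\<close> is normalised there.\<close>
lemma kernel_jets:
  assumes p: "antisymmetric p" and zero: "\<And>t. t \<in> I \<Longrightarrow> jet p 0 1 t = 0"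
  shows "p 0 1 = 0" "p 0 2 = 0" "p 1 3 = 0" "p 0 3 = - p 1 2" "p 2 3 = b 2 s * p 1 2"
    "\<And>t. t \<in> I \<Longrightarrow> (b 1 t - nderiv I 1 (b 2) t) * p 1 2 = 0"
proof -
  note [simp] = jet_diag[OF p]
  note anti = jet_antisym[OF p]
  have suc: "Suc 1 = 2" "Suc 2 = 3" "Suc 3 = 4" by simp_all
  note [simp del] = One_nat_def
  have 02: "jet p 0 2 t = 0" if "t \<in> I" for t
    using jet_deriv_eq_0[OF zero that] by (simp add: suc One_nat_def[symmetric])
  have 12: "jet p 1 2 t + jet p 0 3 t = 0" if "t \<in> I" for t
    using jet_deriv_eq_0[OF 02 that] by (simp add: suc One_nat_def[symmetric])
  have 13: "jet p 1 3 t = 0" if t: "t \<in> I" for t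
  proof -
    have "jet p 1 2 u = - jet p 0 3 u" if "u \<in> I" for u
      using 12[OF that] by (simp add: add_eq_0_iff2)
    from jet_deriv_eq[OF this has_vector_derivative_minus[OF jet_deriv[OF t]] t]
    have "2 * jet p 1 3 t + jet p 0 4 t = 0"
      by (simp add: suc One_nat_def[symmetric] add_eq_0_iff2)
    moreover have "jet p 0 4 t = 0"
      using jet_4[OF t, of p 0] anti[of 4 0 t] anti[of 1 0 t] anti[of 2 0 t] zero[OF t] 02[OF t] by simp
    ultimately show ?thesis by simp
  qed
  have 23: "jet p 2 3 t = b 2 t * jet p 1 2 t" if t: "t \<in> I" for t
    using jet_deriv_eq_0[OF 13 t] jet_4[OF t, of p 1] anti[of 4 1 t] anti[of 2 1 t] zero[OF t]
    by (simp add: suc eq_neg_iff_add_eq_0[symmetric])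
  have "(jet p 1 2 has_vector_derivative 0) (at t within I)" if "t \<in> I" for t
    using jet_deriv[OF that, of p 1 2] 13[OF that] by (simp add: suc)
  then obtain c where c: "\<And>t. t \<in> I \<Longrightarrow> jet p 1 2 t = c"
    using has_vector_derivative_zero_constant[OF is_interval_convex, of I "jet p 1 2"] nondegenerate
    unfolding nondegenerate_interval_def by blast
  have p12: "c = p 1 2"
    using c[OF s] jet_init(4) by simp
  show "p 0 1 = 0" "p 0 2 = 0" "p 1 3 = 0"
    using zero[OF s] 02[OF s] 13[OF s] by (simp_all add: jet_init)
  show "p 0 3 = - p 1 2"
    using 12[OF s] by (simp add: jet_init add_eq_0_iff)
  show "p 2 3 = b 2 s * p 1 2"
    using 23[OF s] by (simp add: jet_init)
  show "(b 1 t - nderiv I 1 (b 2) t) * p 1 2 = 0" if t: "t \<in> I" for t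
  proof -
    have eq: "jet p 2 3 u = b 2 u * c" if "u \<in> I" for u
      using 23[OF that] c[OF that] by simp
    have "jet p 2 4 t = nderiv I 1 (b 2) t * c"
      using jet_deriv_eq[OF eq has_vector_derivative_mult_left[OF smooth_on_deriv0[OF b_smooth t]] t]
      by (simp add: suc)
    moreover have "jet p 2 4 t = b 1 t * c"
      using jet_4[OF t, of p 2] anti[of 4 2 t] 02[OF t] c[OF t] by simp
    ultimately show ?thesis
      by (simp add: p12 algebra_simps)
  qed
qed

text \<open>The system satisfied by \<open>(S\<^sub>0\<^sub>1, S\<^sub>0\<^sub>2, S\<^sub>1\<^sub>2 + S\<^sub>0\<^sub>3, S\<^sub>1\<^sub>3, S\<^sub>2\<^sub>3 - b\<^sub>2 S\<^sub>1\<^sub>2)\<close> when \<open>b\<^sub>1 = b\<^sub>2'\<close>: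
  these five combinations are the ones that \<open>kernel_jets\<close> forces to vanish, and they are closed under
  differentiation.\<close>
definition jet_system :: "real \<Rightarrow> complex \<times> complex \<times> complex \<times> complex \<times> complex \<Rightarrow>
    complex \<times> complex \<times> complex \<times> complex \<times> complex" where
  "jet_system t = (\<lambda>(u, v, w, r, z).
    (v, w, 2 * r - b 2 t * v - b 1 t * u, z + b 0 t * u, b 0 t * v - b 2 t * r))"

lemma linear_system_jet_system: "linear_system I jet_system"
proof (intro linear_system.intro linear_system_axioms.intro interval_axioms)
  show "linear (jet_system t)" for t
    by (rule linearI) (auto simp: jet_system_def algebra_simps scaleR_conv_of_real)
  show "continuous_on I (\<lambda>t. jet_system t (x t))" if "continuous_on I x" for x
    unfolding jet_system_def case_prod_unfold
    by (intro continuous_intros that smooth_on_continuous_on b_smooth) simp_all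
qed

lemma kernel_exists:
  assumes p: "antisymmetric p" and sa: "\<And>t. t \<in> I \<Longrightarrow> b 1 t = nderiv I 1 (b 2) t"
    and init: "p 0 1 = 0" "p 0 2 = 0" "p 1 3 = 0" "p 0 3 = - p 1 2" "p 2 3 = b 2 s * p 1 2"
    and t: "t \<in> I"
  shows "jet p 0 1 t = 0"
proof -
  interpret linear_system I jet_system by (rule linear_system_jet_system)
  note [simp] = jet_diag[OF p]
  note anti = jet_antisym[OF p]
  have suc: "Suc 1 = 2" "Suc 2 = 3" "Suc 3 = 4" by simp_all
  note [simp del] = One_nat_def
  define X where "X t = (jet p 0 1 t, jet p 0 2 t, jet p 1 2 t + jet p 0 3 t, jet p 1 3 t,
    jet p 2 3 t - b 2 t * jet p 1 2 t)" for t
  have "(X has_vector_derivative jet_system t (X t)) (at t within I)" if t: "t \<in> I" for t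
  proof -
    have 4: "jet p 0 4 t = - (b 1 t * jet p 0 1 t + b 2 t * jet p 0 2 t)"
      "jet p 1 4 t = b 0 t * jet p 0 1 t - b 2 t * jet p 1 2 t"
      "jet p 2 4 t = b 0 t * jet p 0 2 t + b 1 t * jet p 1 2 t"
      unfolding anti[of 0 4 t] anti[of 1 4 t] anti[of 2 4 t] jet_4[OF t]
      using anti[of 1 0 t] anti[of 2 0 t] anti[of 2 1 t]
      by (simp_all add: algebra_simps)
    have "jet_system t (X t) = (jet p 1 1 t + jet p 0 2 t, jet p 1 2 t + jet p 0 3 t,
        (jet p 2 2 t + jet p 1 3 t) + (jet p 1 3 t + jet p 0 4 t),
        jet p 2 3 t + jet p 1 4 t,
        (jet p 3 3 t + jet p 2 4 t) - (b 2 t * (jet p 2 2 t + jet p 1 3 t) + nderiv I 1 (b 2) t * jet p 1 2 t))"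
      by (simp add: jet_system_def X_def 4 sa[OF t, symmetric] algebra_simps)
    also have "(X has_vector_derivative \<dots>) (at t within I)"
      unfolding X_def
      using jet_deriv[OF t, of p 0 1] jet_deriv[OF t, of p 0 2] jet_deriv[OF t, of p 0 3]
        jet_deriv[OF t, of p 1 2] jet_deriv[OF t, of p 1 3] jet_deriv[OF t, of p 2 3]
        smooth_on_deriv0[OF b_smooth[of 2] t]
      by (intro has_vector_derivative_Pair has_vector_derivative_add has_vector_derivative_diff
          has_vector_derivative_mult) (simp_all add: suc One_nat_def[symmetric])
    finally show ?thesis .
  qed
  moreover have "X s = 0"
    using init by (simp add: X_def jet_init zero_prod_def)
  ultimately have "X t = 0"
    using zero_solution_unique[of X s t] s t by blast
  then show ?thesis
    by (simp add: X_def zero_prod_def)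
qed

end


section \<open>The Klein quadric\<close>

definition scale_bivector :: "complex \<Rightarrow> (4 \<Rightarrow> 4 \<Rightarrow> complex) \<Rightarrow> 4 \<Rightarrow> 4 \<Rightarrow> complex" where
  "scale_bivector c p = (\<lambda>k l. c * p k l)"

lemma scale_bivector_apply: "scale_bivector c p k l = c * p k l"
  by (simp add: scale_bivector_def)

definition wedge :: "(4 \<Rightarrow> complex) \<Rightarrow> (4 \<Rightarrow> complex) \<Rightarrow> 4 \<Rightarrow> 4 \<Rightarrow> complex" where
  "wedge a b = (\<lambda>k l. a k * b l - a l * b k)"

text \<open>The quadratic form \<open>p \<and> p\<close>, up to a factor.\<close>
definition pfaffian :: "(4 \<Rightarrow> 4 \<Rightarrow> complex) \<Rightarrow> complex" where
  "pfaffian p = p 0 1 * p 2 3 - p 0 2 * p 1 3 + p 0 3 * p 1 2"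

definition klein_quadric :: "(4 \<Rightarrow> 4 \<Rightarrow> complex) set" where
  "klein_quadric = {p. antisymmetric p \<and> pfaffian p = 0 \<and> p \<noteq> 0}"

lemma antisymmetric_wedge: "antisymmetric (wedge a b)"
  by (simp add: antisymmetric_def wedge_def)

lemma antisymmetric_add: "antisymmetric p \<Longrightarrow> antisymmetric q \<Longrightarrow> antisymmetric (p + q)"
  unfolding antisymmetric_def plus_fun_apply
proof (intro allI)
  fix k l
  assume "\<forall>k l. p k l + p l k = 0" "\<forall>k l. q k l + q l k = 0"
  then have "(p k l + p l k) + (q k l + q l k) = 0" by simp
  then show "p k l + q k l + (p l k + q l k) = 0" by (simp only: add_ac)
qed

lemma antisymmetric_scale: "antisymmetric p \<Longrightarrow> antisymmetric (scale_bivector c p)"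
  by (simp add: antisymmetric_def scale_bivector_def distrib_left[symmetric])

lemma antisymmetric_entries:
  assumes "antisymmetric p"
  shows "p 0 0 = 0" "p 1 1 = 0" "p 2 2 = 0" "p 3 3 = 0"
    "p 1 0 = - p 0 1" "p 2 0 = - p 0 2" "p 3 0 = - p 0 3"
    "p 2 1 = - p 1 2" "p 3 1 = - p 1 3" "p 3 2 = - p 2 3"
proof -
  have *: "p k l = - p l k" for k l
    using assms unfolding antisymmetric_def eq_neg_iff_add_eq_0 by blast
  have "p k k = 0" for k
    using *[of k k] by simp
  then show "p 0 0 = 0" "p 1 1 = 0" "p 2 2 = 0" "p 3 3 = 0" by simp_all
  show "p 1 0 = - p 0 1" "p 2 0 = - p 0 2" "p 3 0 = - p 0 3"
    "p 2 1 = - p 1 2" "p 3 1 = - p 1 3" "p 3 2 = - p 2 3"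
    by (rule *)+
qed

lemma antisymmetric_eqI:
  assumes "antisymmetric p" "antisymmetric q"
    and "p 0 1 = q 0 1" "p 0 2 = q 0 2" "p 0 3 = q 0 3" "p 1 2 = q 1 2" "p 1 3 = q 1 3" "p 2 3 = q 2 3"
  shows "p = q"
proof -
  have "\<forall>k l. p k l = q k l"
    unfolding all_index
    by (simp add: antisymmetric_entries[OF assms(1)] antisymmetric_entries[OF assms(2)] assms(3-))
  then show ?thesis by (simp add: fun_eq_iff)
qed

lemma pfaffian_scale: "pfaffian (scale_bivector c p) = c\<^sup>2 * pfaffian p"
  by (simp add: pfaffian_def scale_bivector_def power2_eq_square algebra_simps)

lemma pfaffian_wedge: "pfaffian (wedge a b) = 0"
  by (simp add: pfaffian_def wedge_def algebra_simps)

lemma pluecker_relation: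
  assumes p: "antisymmetric p" and pf: "pfaffian p = 0"
  shows "p k l * p i j = p k i * p l j - p k j * p l i"
proof -
  have pf': "p 0 3 * p 1 2 = p 0 2 * p 1 3 - p 0 1 * p 2 3"
    using pf by (simp add: pfaffian_def algebra_simps add_eq_0_iff)
  have "\<forall>k l i j. p k l * p i j = p k i * p l j - p k j * p l i"
    unfolding all_index
    by (simp add: antisymmetric_entries[OF p] pf' pf'[unfolded mult.commute[of "p 0 3"]] mult.commute)
  then show ?thesis by blast
qed

text \<open>By the Pluecker relations, two rows \<open>k\<close>, \<open>l\<close> of \<open>p\<close> with \<open>p k l \<noteq> 0\<close> have \<open>p\<close> as
  their wedge product up to the factor \<open>p k l\<close>.\<close>
lemma klein_quadric_decomposable:
  assumes "p \<in> klein_quadric"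
  obtains a b where "p = wedge a b"
proof -
  have p: "antisymmetric p" "pfaffian p = 0" "p \<noteq> 0"
    using assms by (auto simp: klein_quadric_def)
  then obtain k l where kl: "p k l \<noteq> 0"
    by (auto simp: fun_eq_iff)
  have "p = wedge (\<lambda>i. p k i / p k l) (p l)"
    using pluecker_relation[OF p(1,2), of k l] kl
    by (auto simp: wedge_def fun_eq_iff field_simps)
  then show ?thesis using that by blast
qed

lemma wedge_in_klein_quadric: "wedge a b \<noteq> 0 \<Longrightarrow> wedge a b \<in> klein_quadric"
  by (simp add: klein_quadric_def antisymmetric_wedge pfaffian_wedge)


section \<open>The Wronski map as a linear projection of the Klein quadric\<close>

lemma comb_add: "comb f (a + b) = comb f a + comb f b"
  by (simp add: comb_def fun_eq_iff sum.distrib distrib_right)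

lemma comb_scale: "comb f (\<lambda>k. c * a k) = cscale c (comb f a)"
  by (simp add: comb_def cscale_def fun_eq_iff sum_distrib_left mult.assoc)

context interval begin

text \<open>The linear extension of the Wronskian to bivectors, where \<open>f\<close> is a basis. For an antisymmetric
  \<open>p\<close>, the double sum counts each minor \<open>f k * f' l - f l * f' k\<close> once.\<close>
definition pencil :: "(4 \<Rightarrow> real \<Rightarrow> complex) \<Rightarrow> (4 \<Rightarrow> 4 \<Rightarrow> complex) \<Rightarrow> real \<Rightarrow> complex" where
  "pencil f p t = (\<Sum>k\<in>UNIV. \<Sum>l\<in>UNIV. p k l * f k t * nderiv I 1 (f l) t)"

lemma pencil_add: "pencil f (p + q) = pencil f p + pencil f q"
  by (simp add: pencil_def fun_eq_iff sum.distrib distrib_right)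

lemma pencil_scale: "pencil f (scale_bivector c p) = cscale c (pencil f p)"
  by (simp add: pencil_def scale_bivector_def cscale_def fun_eq_iff sum_distrib_left mult.assoc)

lemma wronskian_pair: "wronskian I [x, y] t = x t * nderiv I 1 y t - y t * nderiv I 1 x t"
proof -
  let ?A = "Matrix.mat 2 2 (\<lambda>(i, j). nderiv I i ([x, y] ! j) t)"
  have "wronskian I [x, y] t = Determinant.det ?A"
    by (simp add: wronskian_def numeral_2_eq_2)
  also have "\<dots> = (\<Sum>j<2. ?A $$ (0, j) * cofactor ?A 0 j)"
    by (rule laplace_expansion_row) auto
  also have "\<dots> = x t * cofactor ?A 0 0 + y t * cofactor ?A 0 1"
    by (simp add: numeral_2_eq_2)
  also have "cofactor ?A 0 0 = nderiv I 1 y t"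
    unfolding cofactor_def by (subst det_single) (auto simp: mat_delete_def)
  also have "cofactor ?A 0 1 = - nderiv I 1 x t"
    unfolding cofactor_def by (subst det_single) (auto simp: mat_delete_def)
  finally show ?thesis by simp
qed

lemma wronskian_comb:
  assumes f: "\<And>k. f k \<in> Cinf I"
  shows "wronskian I [comb f a, comb f b] = pencil f (wedge a b)"
proof
  fix t
  show "wronskian I [comb f a, comb f b] t = pencil f (wedge a b) t"
  proof (cases "t \<in> I")
    case True
    have D: "nderiv I 1 (comb f a) t = (\<Sum>k\<in>UNIV. a k * nderiv I 1 (f k) t)" for a
      using nderiv_comb[of f t 1 a] f True by (simp add: Cinf_smooth)
    have 1: "(\<Sum>k\<in>UNIV. \<Sum>l\<in>UNIV. a k * b l * f k t * nderiv I 1 (f l) t)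
        = comb f a t * nderiv I 1 (comb f b) t"
      unfolding D comb_def sum_product by (intro sum.cong refl) (simp only: mult_ac)
    have 2: "(\<Sum>k\<in>UNIV. \<Sum>l\<in>UNIV. a l * b k * f k t * nderiv I 1 (f l) t)
        = comb f b t * nderiv I 1 (comb f a) t"
      unfolding D comb_def sum_product by (intro sum.cong refl) (simp only: mult_ac)
    show ?thesis
      unfolding wronskian_pair pencil_def 1[symmetric] 2[symmetric]
      by (simp only: wedge_def left_diff_distrib sum_subtractf)
  next
    case False
    then have "f k t = 0" for k
      using f[of k] by (simp add: Cinf_def)
    then show ?thesis
      by (simp add: wronskian_pair pencil_def comb_def)
  qed
qed

end

lemma independent_pair:
  assumes "x \<noteq> y" "cfun.independent {x, y}" "cscale u x + cscale v y = 0"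
  shows "u = 0" "v = 0"
proof -
  have "(\<Sum>z\<in>{x, y}. cscale (if z = x then u else v) z) = 0"
    using assms(1,3) by (simp)
  then have "\<forall>z\<in>{x, y}. (if z = x then u else v) = 0"
    using cfun.independentD[OF assms(2), of "{x, y}" "\<lambda>z. if z = x then u else v"] by blast
  with assms(1) show "u = 0" "v = 0" by (auto split: if_splits)
qed

lemma independent_pairI:
  assumes "\<And>u v. cscale u x + cscale v y = 0 \<Longrightarrow> u = 0 \<and> v = 0"
  shows "x \<noteq> y" "cfun.independent {x, y}"
proof -
  show "x \<noteq> y"
    using assms[of 1 "- 1"] by (auto simp: cscale_def fun_eq_iff)
  then show "cfun.independent {x, y}"
    using assms by (auto simp: cfun.dependent_finite)
qed

lemma span_pair_iff: "z \<in> cfun.span {x, y} \<longleftrightarrow> (\<exists>u v. z = cscale u x + cscale v y)"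
  by (auto simp: cfun.span_insert cfun.span_singleton algebra_simps)

text \<open>What the computation of the degree needs to know about the kernel of \<open>W\<close>: it is contained
  in the line spanned by one explicit bivector, which depends on a parameter \<open>\<beta>\<close> and lies
  off the Klein quadric.\<close>
locale wronskian_pencil = interval +
  fixes L :: ldo and f :: "4 \<Rightarrow> real \<Rightarrow> complex" and \<beta> :: complex
  assumes sol_space: "sol_space I L = range (comb f)"
    and f_Cinf: "f k \<in> Cinf I"
    and comb_eq_0: "comb f a = 0 \<Longrightarrow> a = 0"
    and kernel: "antisymmetric p \<Longrightarrow> pencil f p = 0 \<Longrightarrow>
      p 0 1 = 0 \<and> p 0 2 = 0 \<and> p 1 3 = 0 \<and> p 0 3 = - p 1 2 \<and> p 2 3 = \<beta> * p 1 2"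
begin

abbreviation V where "V \<equiv> sol_space I L"
abbreviation W where "W \<equiv> pencil f"

text \<open>The rows of a decomposable bivector span the plane that it represents. In this form the plane
  depends visibly on the bivector alone, and only up to a scalar factor.\<close>
definition plane :: "(4 \<Rightarrow> 4 \<Rightarrow> complex) \<Rightarrow> (real \<Rightarrow> complex) set" where
  "plane p = cfun.span (range (\<lambda>k. comb f (p k)))"

lemma plane_wedge:
  assumes "wedge a b \<noteq> 0"
  shows "plane (wedge a b) = cfun.span {comb f a, comb f b}"
proof
  have "comb f (wedge a b k) = cscale (a k) (comb f b) + cscale (- b k) (comb f a)" for k
    by (simp add: comb_def cscale_def wedge_def fun_eq_iff sum_distrib_left sum.distrib[symmetric]
        sum_subtractf[symmetric] algebra_simps)
  note eq = this
  have "comb f (wedge a b k) \<in> cfun.span {comb f a, comb f b}" for k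
    unfolding eq by (intro cfun.span_add cfun.span_scale cfun.span_base) simp_all
  then show "plane (wedge a b) \<subseteq> cfun.span {comb f a, comb f b}"
    unfolding plane_def by (intro cfun.span_minimal) (simp_all add: image_subset_iff)
  obtain k l where kl: "wedge a b k l \<noteq> 0"
    using assms by (auto simp: fun_eq_iff)
  have mem: "comb f c \<in> plane (wedge a b)"
    if "\<And>i. wedge a b k l * c i = c l * wedge a b k i - c k * wedge a b l i" for c
  proof -
    have eq: "comb f c = cscale (c l / wedge a b k l) (comb f (wedge a b k)) + cscale (- c k / wedge a b k l) (comb f (wedge a b l))"
    proof -
      have "c = (\<lambda>i. c l / wedge a b k l * wedge a b k i) + (\<lambda>i. - c k / wedge a b k l * wedge a b l i)"
      proof
        fix i
        have "c i = (c l * wedge a b k i - c k * wedge a b l i) / wedge a b k l"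
          unfolding that[symmetric] using kl by simp
        also have "\<dots> = ((\<lambda>i. c l / wedge a b k l * wedge a b k i) + (\<lambda>i. - c k / wedge a b k l * wedge a b l i)) i"
          by (simp add: diff_divide_distrib)
        finally show "c i = \<dots>" .
      qed
      then show ?thesis
        unfolding comb_scale[symmetric] comb_add[symmetric] by (rule arg_cong)
    qed
    show ?thesis
      unfolding plane_def by (subst eq) (intro cfun.span_add cfun.span_scale cfun.span_base; simp)
  qed
  have "comb f a \<in> plane (wedge a b)" "comb f b \<in> plane (wedge a b)"
    by (rule mem, simp add: wedge_def algebra_simps)+
  then show "cfun.span {comb f a, comb f b} \<subseteq> plane (wedge a b)"
    by (intro cfun.span_minimal) (auto simp: plane_def)
qed

lemma plane_scale:
  assumes "c \<noteq> 0"
  shows "plane (scale_bivector c p) = plane p"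
proof -
  have le: "plane (scale_bivector c p) \<subseteq> plane p" for c p
    unfolding plane_def
    by (intro cfun.span_minimal)
      (auto simp: scale_bivector_def comb_scale intro: cfun.span_scale cfun.span_base)
  have "scale_bivector (1 / c) (scale_bivector c p) = p"
    using assms by (simp add: scale_bivector_def fun_eq_iff)
  with le[of "1 / c" "scale_bivector c p"] le[of c p] show ?thesis by auto
qed

lemma comb_independent:
  assumes "wedge a b \<noteq> 0"
  shows "comb f a \<noteq> comb f b" "cfun.independent {comb f a, comb f b}"
proof -
  have *: "u = 0 \<and> v = 0" if "cscale u (comb f a) + cscale v (comb f b) = 0" for u v
  proof -
    have "(\<lambda>k. u * a k) + (\<lambda>k. v * b k) = 0"
      using that by (intro comb_eq_0) (simp add: comb_add comb_scale)
    then have eq: "u * a k + v * b k = 0" for k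
      by (simp add: fun_eq_iff)
    obtain k l where "wedge a b k l \<noteq> 0"
      using assms by (auto simp: fun_eq_iff)
    moreover have "u * wedge a b k l = (u * a k + v * b k) * b l - (u * a l + v * b l) * b k"
      "v * wedge a b k l = (u * a l + v * b l) * a k - (u * a k + v * b k) * a l"
      by (simp_all add: wedge_def algebra_simps)
    ultimately show ?thesis unfolding eq by simp
  qed
  show "comb f a \<noteq> comb f b"
    by (rule independent_pairI(1)[OF *])
  show "cfun.independent {comb f a, comb f b}"
    by (rule independent_pairI(2)[OF *])
qed

lemma wedge_nonzero:
  assumes "comb f a \<noteq> comb f b" "cfun.independent {comb f a, comb f b}"
  shows "wedge a b \<noteq> 0"
proof
  assume "wedge a b = 0"
  then have eq: "a k * b l = a l * b k" for k l
    by (auto simp: wedge_def fun_eq_iff)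
  have "cscale (b k) (comb f a) + cscale (- a k) (comb f b) = 0" for k
  proof -
    have "(\<lambda>i. b k * a i) + (\<lambda>i. - a k * b i) = 0"
      using eq by (auto simp: fun_eq_iff mult.commute)
    moreover have "comb f 0 = 0" by (simp add: comb_def fun_eq_iff)
    ultimately show ?thesis
      unfolding comb_scale[symmetric] comb_add[symmetric] by simp
  qed
  note dep = this
  have "b k = 0" "- a k = 0" for k
    using independent_pair[OF assms dep[of k]] by simp_all
  then have "a = b" by (auto simp: fun_eq_iff)
  with assms(1) show False by simp
qed

lemma comb_eqD: "comb f a = comb f b \<Longrightarrow> a = b"
proof -
  assume "comb f a = comb f b"
  then have "comb f (a + (\<lambda>k. (-1) * b k)) = 0"
    unfolding comb_add comb_scale by (simp add: cscale_def fun_eq_iff)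
  then have "a + (\<lambda>k. (-1) * b k) = 0" by (rule comb_eq_0)
  then show "a = b" by (auto simp: fun_eq_iff)
qed

text \<open>A change of basis in the plane multiplies the wedge product by its determinant.\<close>
lemma plane_eqD:
  assumes p: "p \<in> klein_quadric" and q: "q \<in> klein_quadric" and eq: "plane p = plane q"
  obtains c where "c \<noteq> 0" "q = scale_bivector c p"
proof -
  obtain a b where ab: "p = wedge a b" using klein_quadric_decomposable[OF p] .
  obtain a' b' where ab': "q = wedge a' b'" using klein_quadric_decomposable[OF q] .
  have nz: "p \<noteq> 0" "q \<noteq> 0" using p q by (auto simp: klein_quadric_def)
  have "comb f a' \<in> plane p" "comb f b' \<in> plane p"
    using nz unfolding eq ab' by (auto simp: plane_wedge intro: cfun.span_base)
  then obtain u v u' v' where "comb f a' = cscale u (comb f a) + cscale v (comb f b)"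
    "comb f b' = cscale u' (comb f a) + cscale v' (comb f b)"
    using nz unfolding ab by (auto simp: plane_wedge span_pair_iff)
  then have "a' = (\<lambda>k. u * a k) + (\<lambda>k. v * b k)" "b' = (\<lambda>k. u' * a k) + (\<lambda>k. v' * b k)"
    unfolding comb_scale[symmetric] comb_add[symmetric] by (auto dest: comb_eqD)
  then have "q = scale_bivector (u * v' - v * u') p"
    by (simp add: ab ab' wedge_def scale_bivector_def fun_eq_iff algebra_simps)
  moreover from this nz have "u * v' - v * u' \<noteq> 0"
    by (auto simp: scale_bivector_def fun_eq_iff)
  ultimately show ?thesis using that by blast
qed

text \<open>The Pfaffian of a member \<open>p\<close> of the kernel is \<open>- (p 1 2)\<^sup>2\<close>, and \<open>p\<close> is determined by
  \<open>p 1 2\<close>.\<close>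
lemma W_inj:
  assumes p: "p \<in> klein_quadric"
  shows "W p \<noteq> 0"
proof
  assume "W p = 0"
  with p kernel[of p] have k: "p 0 1 = 0" "p 0 2 = 0" "p 1 3 = 0" "p 0 3 = - p 1 2" "p 2 3 = \<beta> * p 1 2"
    by (auto simp: klein_quadric_def)
  moreover have "pfaffian p = 0" using p by (simp add: klein_quadric_def)
  ultimately have "p 1 2 = 0"
    by (simp add: pfaffian_def)
  with k p have "p = 0"
    by (intro antisymmetric_eqI) (auto simp: klein_quadric_def antisymmetric_def)
  with p show False by (simp add: klein_quadric_def)
qed

lemma plane_in_grassmannian:
  assumes "wedge a b \<noteq> 0"
  shows "plane (wedge a b) \<in> grassmannian 2 V"
proof -
  have "cfun.subspace V" unfolding sol_space
    unfolding cfun.subspace_def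
    by (auto simp: comb_add[symmetric] comb_scale[symmetric] intro: image_eqI[of _ _ 0] simp: comb_def fun_eq_iff)
  then have "cfun.span {comb f a, comb f b} \<subseteq> V"
    by (intro cfun.span_minimal) (auto simp: sol_space)
  moreover have "cfun.dim (cfun.span {comb f a, comb f b}) = 2"
    using comb_independent[OF assms] by (simp add: cfun.dim_eq_card_independent)
  ultimately show ?thesis
    by (simp add: grassmannian_def plane_wedge[OF assms])
qed

text \<open>The basis in the definition of the Wronski map is an arbitrary choice; the bivector \<open>p\<close> found here
  is the wedge product of that basis.\<close>
lemma grassmannian_cases:
  assumes \<Lambda>: "\<Lambda> \<in> grassmannian 2 V"
  obtains p where "p \<in> klein_quadric" "\<Lambda> = plane p" "wronski_map I \<Lambda> = cfun.span {W p}"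
proof -
  have sub: "cfun.subspace \<Lambda>" "\<Lambda> \<subseteq> V" "cfun.dim \<Lambda> = 2"
    using \<Lambda> by (auto simp: grassmannian_def)
  obtain B where B: "B \<subseteq> \<Lambda>" "cfun.independent B" "\<Lambda> \<subseteq> cfun.span B" "card B = 2"
    using cfun.basis_exists[of \<Lambda>] sub(3) by metis
  then obtain x y where xy: "B = {x, y}" "x \<noteq> y"
    by (auto simp: card_2_iff)
  have "is_basis_list [x, y] \<Lambda>"
    using B xy sub(1) cfun.span_minimal[OF B(1) sub(1)] by (auto simp: is_basis_list_def)
  then have basis: "is_basis_list (SOME fs. is_basis_list fs \<Lambda>) \<Lambda>"
    by (rule someI)
  \<comment> \<open>The chosen basis list has two entries because the dimension is 2.\<close>
  define fs where "fs = (SOME fs. is_basis_list fs \<Lambda>)"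
  have fs: "distinct fs" "cfun.independent (set fs)" "cfun.span (set fs) = \<Lambda>"
    using basis by (auto simp: is_basis_list_def fs_def)
  then have "length fs = 2"
    using sub(3) cfun.dim_span_eq_card_independent[of "set fs"] by (simp add: distinct_card)
  then obtain x y where fs_eq: "fs = [x, y]"
    by (auto simp: numeral_2_eq_2 length_Suc_conv)
  have "x \<in> V" "y \<in> V"
    using fs(3) sub(2) cfun.span_base[of _ "set fs"] by (auto simp: fs_eq)
  then obtain a b where ab: "x = comb f a" "y = comb f b"
    unfolding sol_space by auto
  have nz: "wedge a b \<noteq> 0"
    using fs by (intro wedge_nonzero) (auto simp: fs_eq ab)
  show ?thesis
  proof (rule that[of "wedge a b"])
    show "wedge a b \<in> klein_quadric"
      using nz by (rule wedge_in_klein_quadric)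
    show "\<Lambda> = plane (wedge a b)"
      using fs(3) by (simp add: plane_wedge[OF nz] fs_eq ab)
    show "wronski_map I \<Lambda> = cfun.span {W (wedge a b)}"
      unfolding wronski_map_def fs_def[symmetric] fs_eq ab wronskian_comb[OF f_Cinf] ..
  qed
qed

lemma span_W_scale: "c \<noteq> 0 \<Longrightarrow> cfun.span {W (scale_bivector c p)} = cfun.span {W p}"
  unfolding pencil_scale using cfun.span_image_scale[of "{W p}" "\<lambda>_. c"] by simp

lemma wronski_map_plane:
  assumes p: "p \<in> klein_quadric"
  shows "plane p \<in> grassmannian 2 V" "wronski_map I (plane p) = cfun.span {W p}"
proof -
  obtain a b where "p = wedge a b" using klein_quadric_decomposable[OF p] .
  then show gr: "plane p \<in> grassmannian 2 V"
    using p plane_in_grassmannian by (auto simp: klein_quadric_def)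
  obtain q where q: "q \<in> klein_quadric" "plane p = plane q" "wronski_map I (plane p) = cfun.span {W q}"
    using grassmannian_cases[OF gr] by metis
  obtain c where "c \<noteq> 0" "q = scale_bivector c p"
    using plane_eqD[OF p q(1,2)] .
  with q(3) show "wronski_map I (plane p) = cfun.span {W p}"
    by (simp add: span_W_scale)
qed

lemma wronski_image_eq: "wronski_image I L 2 = (\<lambda>p. cfun.span {W p}) ` klein_quadric"
  unfolding wronski_image_def
proof (intro equalityI subsetI)
  fix y assume "y \<in> wronski_map I ` grassmannian 2 V"
  then show "y \<in> (\<lambda>p. cfun.span {W p}) ` klein_quadric"
    using grassmannian_cases by (metis (no_types, lifting) image_iff)
next
  fix y assume "y \<in> (\<lambda>p. cfun.span {W p}) ` klein_quadric"
  then show "y \<in> wronski_map I ` grassmannian 2 V"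
    using wronski_map_plane by blast
qed

lemma fibre_eq:
  assumes "p \<in> klein_quadric"
  shows "{\<Lambda> \<in> grassmannian 2 V. wronski_map I \<Lambda> = cfun.span {W p}} =
    plane ` {q \<in> klein_quadric. \<exists>c. c \<noteq> 0 \<and> W q = cscale c (W p)}"
proof -
  have span_eq: "cfun.span {W q} = cfun.span {W p} \<longleftrightarrow> (\<exists>c. c \<noteq> 0 \<and> W q = cscale c (W p))"
    if "q \<in> klein_quadric" for q
  proof
    assume "cfun.span {W q} = cfun.span {W p}"
    then have "W q \<in> cfun.span {W p}"
      using cfun.span_base[of "W q" "{W q}"] by simp
    then obtain c where c: "W q = cscale c (W p)"
      by (auto simp: cfun.span_singleton)
    then have "c \<noteq> 0"
      using W_inj[OF that] by (auto simp: cscale_def fun_eq_iff)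
    with c show "\<exists>c. c \<noteq> 0 \<and> W q = cscale c (W p)" by blast
  next
    assume "\<exists>c. c \<noteq> 0 \<and> W q = cscale c (W p)"
    then obtain c where "c \<noteq> 0" "W q = W (scale_bivector c p)"
      by (auto simp: pencil_scale)
    then show "cfun.span {W q} = cfun.span {W p}"
      using span_W_scale by metis
  qed
  show ?thesis
  proof (intro equalityI subsetI)
    fix \<Lambda> assume "\<Lambda> \<in> {\<Lambda> \<in> grassmannian 2 V. wronski_map I \<Lambda> = cfun.span {W p}}"
    then have \<Lambda>: "\<Lambda> \<in> grassmannian 2 V" "wronski_map I \<Lambda> = cfun.span {W p}" by auto
    obtain q where "q \<in> klein_quadric" "\<Lambda> = plane q" "wronski_map I \<Lambda> = cfun.span {W q}"
      using grassmannian_cases[OF \<Lambda>(1)] .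
    then show "\<Lambda> \<in> plane ` {q \<in> klein_quadric. \<exists>c. c \<noteq> 0 \<and> W q = cscale c (W p)}"
      using \<Lambda>(2) span_eq by auto
  next
    fix \<Lambda> assume "\<Lambda> \<in> plane ` {q \<in> klein_quadric. \<exists>c. c \<noteq> 0 \<and> W q = cscale c (W p)}"
    then obtain q where q: "\<Lambda> = plane q" "q \<in> klein_quadric" "\<exists>c. c \<noteq> 0 \<and> W q = cscale c (W p)"
      by blast
    then have "cfun.span {W q} = cfun.span {W p}"
      using span_eq by blast
    with q show "\<Lambda> \<in> {\<Lambda> \<in> grassmannian 2 V. wronski_map I \<Lambda> = cfun.span {W p}}"
      by (simp add: wronski_map_plane)
  qed
qed

end


section \<open>The degree of the projection\<close>

text \<open>The condition on \<open>d\<close> and \<open>U\<close> in the definition of the degree.\<close>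
definition generic_fibre_card :: "real set \<Rightarrow> ldo \<Rightarrow> nat \<Rightarrow> (real \<Rightarrow> complex) set set \<Rightarrow> nat \<Rightarrow> bool" where
  "generic_fibre_card I L m U d \<longleftrightarrow>
     openin (subtopology zariski (wronski_image I L m)) U \<and>
     (subtopology zariski (wronski_image I L m)) closure_of U = wronski_image I L m \<and>
     (\<forall>y\<in>U. finite {\<Lambda> \<in> grassmannian m (sol_space I L). wronski_map I \<Lambda> = y} \<and>
            card {\<Lambda> \<in> grassmannian m (sol_space I L). wronski_map I \<Lambda> = y} = d)"

lemma topspace_zariski: "topspace zariski = proj_space"
proof (rule equalityI)
  obtain F where "topspace zariski = proj_space - zero_locus F"
    using openin_topspace[of zariski] unfolding openin_zariski by blast
  then show "topspace zariski \<subseteq> proj_space" by blast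
  have "homog_poly 0 (\<lambda>_. 1)" by (rule homog_poly_const)
  moreover have "zero_locus {\<lambda>_. 1} = {}"
    by (auto simp: zero_locus_def proj_space_def dest: spec[of _ 0] intro: cfun.span_zero)
  ultimately have "openin zariski proj_space"
    unfolding openin_zariski by (intro exI[of _ "{\<lambda>_. 1}"]) auto
  then show "proj_space \<subseteq> topspace zariski" by (rule openin_subset)
qed

text \<open>The degree is well defined because a dense set meets every nonempty open set.\<close>
lemma wronski_degree_eqI:
  assumes U: "generic_fibre_card I L m U d"
    and ne: "wronski_image I L m \<noteq> {}" and proj: "wronski_image I L m \<subseteq> proj_space"
  shows "wronski_degree I L m = d"
  unfolding wronski_degree_def generic_fibre_card_def[symmetric]
proof (rule the_equality)
  show "\<exists>U. generic_fibre_card I L m U d" using U by blast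
  fix d' assume "\<exists>U. generic_fibre_card I L m U d'"
  then obtain U' where U': "generic_fibre_card I L m U' d'" by blast
  let ?X = "subtopology zariski (wronski_image I L m)"
  have top: "topspace ?X = wronski_image I L m"
    using proj by (auto simp: topspace_zariski)
  have "U' \<noteq> {}"
    using U' ne by (auto simp: generic_fibre_card_def)
  moreover have "openin ?X U'" using U' by (simp add: generic_fibre_card_def)
  moreover have "?X closure_of U = topspace ?X" using U top by (simp add: generic_fibre_card_def)
  ultimately have "U \<inter> U' \<noteq> {}"
    unfolding dense_intersects_open by blast
  then show "d' = d"
    using U U' by (auto simp: generic_fibre_card_def)
qed

lemma homog_poly_line_continuous:
  assumes "homog_poly d P"
  shows "continuous_on UNIV (\<lambda>z. P (x + cscale z y))"
  using assms
proof induction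
  case (homog_poly_linear_mult \<phi> d P)
  interpret \<phi>: Vector_Spaces.linear cscale "(*)" \<phi> by fact
  have "(\<lambda>z. \<phi> (x + cscale z y)) = (\<lambda>z. \<phi> x + z * \<phi> y)"
    by (simp add: \<phi>.add \<phi>.scale)
  then have "continuous_on UNIV (\<lambda>z. \<phi> (x + cscale z y))"
    by (simp only:) (intro continuous_intros)
  then show ?case
    using homog_poly_linear_mult.IH by (intro continuous_on_mult)
qed (auto intro: continuous_on_add)

text \<open>A homogeneous polynomial that does not vanish at \<open>x\<close> does not vanish near \<open>x\<close> on a line
  through \<open>x\<close>, by continuity. This is how points of Zariski open sets are moved.\<close>
lemma homog_poly_nonzero_on_line:
  assumes "homog_poly d P" "P x \<noteq> 0"
  obtains z where "z \<noteq> 0" "P (x + cscale z y) \<noteq> 0"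
proof -
  have "isCont (\<lambda>z. P (x + cscale z y)) 0"
    using homog_poly_line_continuous[OF assms(1)] by (simp add: continuous_on_eq_continuous_at)
  then have "((\<lambda>z. P (x + cscale z y)) \<longlongrightarrow> P (x + cscale 0 y)) (at 0)"
    by (simp add: isCont_def)
  moreover have "P (x + cscale 0 y) \<noteq> 0"
    using assms(2) by (simp add: cscale_def plus_fun_def)
  ultimately have "\<forall>\<^sub>F z in at 0. P (x + cscale z y) \<noteq> 0"
    by (rule tendsto_imp_eventually_ne)
  then have "\<forall>\<^sub>F z in at 0. z \<noteq> 0 \<and> P (x + cscale z y) \<noteq> 0"
    by (intro eventually_conj eventually_neq_at_within)
  then have "\<exists>z. z \<noteq> 0 \<and> P (x + cscale z y) \<noteq> 0"
    using eventually_happens'[OF trivial_limit_at] by blast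
  then show ?thesis using that by blast
qed

context wronskian_pencil
begin

text \<open>The bivector that spans the line allowed for the kernel: the centre of the projection.\<close>
definition centre :: "4 \<Rightarrow> 4 \<Rightarrow> complex" where
  "centre k l =
     (if k = 1 \<and> l = 2 then 1 else if k = 2 \<and> l = 1 then - 1
      else if k = 0 \<and> l = 3 then - 1 else if k = 3 \<and> l = 0 then 1
      else if k = 2 \<and> l = 3 then \<beta> else if k = 3 \<and> l = 2 then - \<beta> else 0)"

lemma antisymmetric_centre: "antisymmetric centre"
  unfolding antisymmetric_def all_index by (simp add: centre_def)

lemma centre_entries:
  "centre 0 1 = 0" "centre 0 2 = 0" "centre 0 3 = - 1" "centre 1 2 = 1" "centre 1 3 = 0" "centre 2 3 = \<beta>"
  by (simp_all add: centre_def)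

lemma kernel_centre:
  assumes "antisymmetric p" "W p = 0"
  shows "p = scale_bivector (p 1 2) centre"
  using kernel[OF assms]
  by (intro antisymmetric_eqI assms antisymmetric_scale antisymmetric_centre)
    (simp_all add: scale_bivector_def centre_entries)

text \<open>The polar form of the Pfaffian with respect to the centre.\<close>
definition polar :: "(4 \<Rightarrow> 4 \<Rightarrow> complex) \<Rightarrow> complex" where
  "polar p = \<beta> * p 0 1 + p 0 3 - p 1 2"

lemma pfaffian_centre: "pfaffian centre = - 1"
  by (simp add: pfaffian_def centre_entries)

text \<open>Hence a line through the centre and a point \<open>p\<close> of the quadric meets the quadric again
  in \<open>p + polar p * centre\<close>.\<close>
lemma pfaffian_add_centre: "pfaffian (p + scale_bivector c centre) = pfaffian p + c * polar p - c\<^sup>2"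
  by (simp add: pfaffian_def polar_def scale_bivector_def centre_entries power2_eq_square algebra_simps)

lemma wronski_image_props: "wronski_image I L 2 \<noteq> {}" "wronski_image I L 2 \<subseteq> proj_space"
proof -
  have "wedge (\<lambda>k. of_bool (k = 0)) (\<lambda>k. of_bool (k = 1)) 0 1 \<noteq> 0"
    by (simp add: wedge_def)
  then have "wedge (\<lambda>k. of_bool (k = 0)) (\<lambda>k. of_bool (k = 1)) \<noteq> 0"
    by (metis zero_fun_apply)
  then show "wronski_image I L 2 \<noteq> {}"
    using wedge_in_klein_quadric by (auto simp: wronski_image_eq)
  show "wronski_image I L 2 \<subseteq> proj_space"
    using W_inj by (auto simp: wronski_image_eq proj_space_def)
qed

lemma relation_of_proportional:
  assumes p: "p \<in> klein_quadric" and q: "q \<in> klein_quadric" and c: "W q = cscale c (W p)"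
  obtains e where "W (scale_bivector e centre) = 0" "q = scale_bivector c p + scale_bivector e centre"
proof -
  define r where "r = q + scale_bivector (- c) p"
  have r: "antisymmetric r"
    using p q by (auto simp: r_def klein_quadric_def intro: antisymmetric_add antisymmetric_scale)
  have W_r: "W r = 0"
    by (simp add: r_def pencil_add pencil_scale c cscale_def fun_eq_iff)
  have "r = scale_bivector (r 1 2) centre"
    by (rule kernel_centre[OF r W_r])
  moreover have "q = scale_bivector c p + r"
    by (simp add: r_def scale_bivector_def fun_eq_iff)
  ultimately show ?thesis
    using that[of "r 1 2"] W_r by simp
qed

lemma degree_1:
  assumes W_centre: "W centre \<noteq> 0"
  shows "wronski_degree I L 2 = 1"
proof (rule wronski_degree_eqI)
  have fibre: "{\<Lambda> \<in> grassmannian 2 V. wronski_map I \<Lambda> = cfun.span {W p}} = {plane p}"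
    if p: "p \<in> klein_quadric" for p
  proof -
    have "plane q = plane p" if q: "q \<in> klein_quadric" and c: "c \<noteq> 0" "W q = cscale c (W p)" for q c
    proof -
      obtain e where e: "W (scale_bivector e centre) = 0" "q = scale_bivector c p + scale_bivector e centre"
        using relation_of_proportional[OF p q c(2)] .
      from e(1) W_centre have "e = 0"
        by (auto simp: pencil_scale cscale_def fun_eq_iff)
      then have "q = scale_bivector c p"
        using e(2) by (simp add: scale_bivector_def fun_eq_iff)
      then show ?thesis by (simp add: plane_scale[OF c(1)])
    qed
    moreover have "p \<in> {q \<in> klein_quadric. \<exists>c. c \<noteq> 0 \<and> W q = cscale c (W p)}"
      using p by (auto intro!: exI[of _ 1] simp: cscale_def)
    ultimately show ?thesis
      unfolding fibre_eq[OF p] by auto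
  qed
  have "openin (subtopology zariski (wronski_image I L 2)) (wronski_image I L 2)"
    using wronski_image_props openin_topspace[of "subtopology zariski (wronski_image I L 2)"]
    by (simp add: topspace_zariski Int_absorb1)
  moreover have "(subtopology zariski (wronski_image I L 2)) closure_of (wronski_image I L 2) = wronski_image I L 2"
    using wronski_image_props closure_of_topspace[of "subtopology zariski (wronski_image I L 2)"]
    by (simp add: topspace_zariski Int_absorb1)
  ultimately show "generic_fibre_card I L 2 (wronski_image I L 2) 1"
    unfolding generic_fibre_card_def by (auto simp: wronski_image_eq fibre)
qed (rule wronski_image_props)+

text \<open>The second point of intersection with the line through the centre.\<close>
definition involution :: "(4 \<Rightarrow> 4 \<Rightarrow> complex) \<Rightarrow> 4 \<Rightarrow> 4 \<Rightarrow> complex" where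
  "involution p = p + scale_bivector (polar p) centre"

context
  assumes W_centre: "W centre = 0"
begin

lemma W_add_centre: "W (p + scale_bivector c centre) = W p"
  by (simp add: pencil_add pencil_scale W_centre cscale_def fun_eq_iff)

lemma involution_klein_quadric:
  assumes "p \<in> klein_quadric"
  shows "involution p \<in> klein_quadric"
proof -
  have "W (involution p) \<noteq> 0"
    using W_inj[OF assms] by (simp add: involution_def W_add_centre)
  moreover have "W 0 = 0"
    by (simp add: pencil_def fun_eq_iff)
  ultimately have "involution p \<noteq> 0" by auto
  moreover have "antisymmetric (involution p)"
    using assms by (auto simp: klein_quadric_def involution_def
        intro: antisymmetric_add antisymmetric_scale antisymmetric_centre)
  moreover have "pfaffian (involution p) = 0"
    using assms by (simp add: involution_def pfaffian_add_centre klein_quadric_def power2_eq_square)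
  ultimately show ?thesis by (simp add: klein_quadric_def)
qed

lemma fibre_pair:
  assumes p: "p \<in> klein_quadric"
  shows "{\<Lambda> \<in> grassmannian 2 V. wronski_map I \<Lambda> = cfun.span {W p}} = {plane p, plane (involution p)}"
proof -
  have "plane q \<in> {plane p, plane (involution p)}"
    if q: "q \<in> klein_quadric" and c: "c \<noteq> 0" "W q = cscale c (W p)" for q c
  proof -
    obtain e where q_eq: "q = scale_bivector c p + scale_bivector e centre"
      using relation_of_proportional[OF p q c(2)] .
    have "pfaffian q = 0" "pfaffian p = 0"
      using p q by (auto simp: klein_quadric_def)
    moreover have "polar (scale_bivector c p) = c * polar p"
      by (simp add: polar_def scale_bivector_def algebra_simps)
    ultimately have "e * (c * polar p - e) = 0"
      unfolding q_eq pfaffian_add_centre pfaffian_scale by (simp add: power2_eq_square algebra_simps)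
    then consider "e = 0" | "e = c * polar p" by auto
    then show ?thesis
    proof cases
      case 1
      then have "q = scale_bivector c p"
        using q_eq by (simp add: scale_bivector_def fun_eq_iff)
      then show ?thesis by (simp add: plane_scale[OF c(1)])
    next
      case 2
      then have "q = scale_bivector c (involution p)"
        using q_eq by (simp add: involution_def scale_bivector_def fun_eq_iff algebra_simps)
      then show ?thesis by (simp add: plane_scale[OF c(1)])
    qed
  qed
  moreover have "W p = cscale 1 (W p)" "W (involution p) = cscale 1 (W p)"
    by (simp_all add: involution_def W_add_centre cscale_def)
  moreover note p involution_klein_quadric[OF p]
  ultimately show ?thesis
    unfolding fibre_eq[OF p] by (auto intro!: imageI intro: zero_neq_one[symmetric])
qed

lemma planes_distinct:
  assumes p: "p \<in> klein_quadric" and "polar p \<noteq> 0"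
  shows "plane p \<noteq> plane (involution p)"
proof
  assume "plane p = plane (involution p)"
  then obtain c where c: "involution p = scale_bivector c p"
    using plane_eqD[OF p involution_klein_quadric[OF p]] by blast
  have "scale_bivector (polar p) centre = scale_bivector (c - 1) p"
  proof (intro ext)
    fix k l
    have "involution p k l = scale_bivector c p k l" by (simp only: c)
    then show "scale_bivector (polar p) centre k l = scale_bivector (c - 1) p k l"
      by (simp add: involution_def scale_bivector_def algebra_simps)
  qed
  then have "pfaffian (scale_bivector (polar p) centre) = pfaffian (scale_bivector (c - 1) p)"
    by simp
  with p assms(2) show False
    by (simp add: pfaffian_scale pfaffian_centre klein_quadric_def)
qed

end

end

lemma vector_space_bivectors: "vector_space scale_bivector"
  by standard (simp_all add: scale_bivector_def fun_eq_iff algebra_simps)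

context wronskian_pencil
begin

text \<open>The discriminant of the quadratic polynomial \<open>c \<mapsto> pfaffian (p + c * centre)\<close> does not change when
  \<open>p\<close> moves in the direction of the centre. So it is a quadratic form in \<open>W p\<close>, and its zero
  locus is the branch locus of the projection.\<close>
lemma discriminant_form:
  assumes W_centre: "W centre = 0"
  shows "\<exists>P. homog_poly 2 P \<and> (\<forall>p. antisymmetric p \<longrightarrow> P (W p) = (polar p)\<^sup>2 + 4 * pfaffian p)"
proof -
  interpret bivector: vector_space scale_bivector by (rule vector_space_bivectors)
  interpret pair: vector_space_pair scale_bivector cscale by standard
  \<comment> \<open>A complement of the centre in the space of bivectors. The coordinates of the member of \<open>S\<close>
    that represents a bivector modulo the centre are linear functionals of its image under \<open>W\<close>.\<close>
  define S where "S = {p. antisymmetric p \<and> p 1 2 = 0}"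
  have S: "bivector.subspace S"
    unfolding bivector.subspace_def S_def
    by (auto intro: antisymmetric_add antisymmetric_scale simp: scale_bivector_apply)
      (simp add: antisymmetric_def)
  have W: "Vector_Spaces.linear scale_bivector cscale W"
    by standard (simp_all add: pencil_add pencil_scale)
  have span: "bivector.span S = S"
    using S by (simp only: bivector.span_eq_iff)
  have inj: "inj_on W S"
  proof (rule inj_onI)
    fix p q assume pq: "p \<in> S" "q \<in> S" "W p = W q"
    define r where "r = p + scale_bivector (- 1) q"
    have "r \<in> S"
      unfolding r_def using pq by (intro bivector.subspace_add[OF S] bivector.subspace_scale[OF S])
    moreover have "W r = 0"
      unfolding r_def pencil_add pencil_scale pq(3) by (simp add: cscale_def fun_eq_iff)
    ultimately have "r = scale_bivector 0 centre"
      using kernel_centre[of r] by (simp add: S_def)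
    then show "p = q"
      by (simp add: r_def scale_bivector_def fun_eq_iff)
  qed
  obtain G where G: "Vector_Spaces.linear cscale scale_bivector G" "\<And>p. p \<in> S \<Longrightarrow> G (W p) = p"
    using pair.linear_inj_on_left_inverse[OF W, of S, unfolded span, OF inj] by blast
  interpret G: Vector_Spaces.linear cscale scale_bivector G by (rule G(1))
  have entry: "Vector_Spaces.linear cscale (*) (\<lambda>x. G x k l)" for k l
    by standard (simp_all add: G.add G.scale scale_bivector_def algebra_simps)
  have sum: "Vector_Spaces.linear cscale (*) (\<lambda>x. \<beta> * G x 0 1 + G x 0 3)"
    by standard (simp_all add: G.add G.scale scale_bivector_def algebra_simps)
  define P where "P x = (\<beta> * G x 0 1 + G x 0 3) * ((\<beta> * G x 0 1 + G x 0 3) * 1)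
    + (G x 0 1 * (G x 2 3 * 4) + G x 0 2 * (G x 1 3 * (- 4)))" for x
  have "homog_poly 2 P"
    unfolding P_def[abs_def] numeral_2_eq_2
    by (intro homog_poly_add homog_poly_linear_mult homog_poly_const entry sum)
  moreover have "P (W p) = (polar p)\<^sup>2 + 4 * pfaffian p" if p: "antisymmetric p" for p
  proof -
    define q where "q = p + scale_bivector (- p 1 2) centre"
    have "antisymmetric q"
      unfolding q_def by (intro antisymmetric_add antisymmetric_scale p antisymmetric_centre)
    then have "q \<in> S"
      by (simp add: S_def q_def scale_bivector_def centre_entries)
    moreover have "W q = W p"
      unfolding q_def by (rule W_add_centre[OF W_centre])
    ultimately have "G (W p) = q"
      using G(2)[of q] by simp
    then show ?thesis
      by (simp add: P_def q_def scale_bivector_def centre_entries polar_def pfaffian_def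
          power2_eq_square algebra_simps)
  qed
  ultimately show ?thesis by blast
qed

text \<open>\<open>c, b \<mapsto> polar (wedge c b)\<close> is a nondegenerate alternating form, in other words the centre is
  not decomposable.\<close>
lemma polar_nondegenerate:
  assumes "wedge a b \<noteq> 0"
  obtains c where "polar (wedge c b) \<noteq> 0"
proof -
  have polar: "polar (wedge c b) = c 0 * (\<beta> * b 1 + b 3) - c 1 * (\<beta> * b 0 + b 2) + c 2 * b 1 - c 3 * b 0" for c
    by (simp add: polar_def wedge_def algebra_simps)
  have "\<exists>c. polar (wedge c b) \<noteq> 0"
  proof (rule ccontr)
    assume "\<not> ?thesis"
    then have zero: "polar (wedge (\<lambda>k. of_bool (k = i)) b) = 0" for i by blast
    have "b 0 = 0" "b 1 = 0"
      using zero[of 3] zero[of 2] unfolding polar by simp_all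
    moreover from this have "b 2 = 0" "b 3 = 0"
      using zero[of 1] zero[of 0] unfolding polar by simp_all
    ultimately have "\<forall>k. b k = 0" unfolding all_index by simp
    then have "wedge a b = 0" by (simp add: wedge_def fun_eq_iff)
    with assms show False by blast
  qed
  then show ?thesis using that by blast
qed

text \<open>Off the branch locus the fibres have two elements. For density, a point of the branch locus is moved
  out of it along a line \<open>(a + z c) \<and> b\<close> of the Klein quadric on which the polar form is not
  constant.\<close>
lemma degree_2:
  assumes W_centre: "W centre = 0"
  shows "wronski_degree I L 2 = 2"
proof (rule wronski_degree_eqI)
  let ?X = "subtopology zariski (wronski_image I L 2)"
  let ?U = "(\<lambda>p. cfun.span {W p}) ` {p \<in> klein_quadric. polar p \<noteq> 0}"
  obtain P where P: "homog_poly 2 P"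
    "\<And>p. antisymmetric p \<Longrightarrow> P (W p) = (polar p)\<^sup>2 + 4 * pfaffian p"
    using discriminant_form[OF W_centre] by blast
  have U_eq: "?U = (proj_space - zero_locus {P}) \<inter> wronski_image I L 2"
  proof -
    have "cfun.span {W p} \<in> zero_locus {P} \<longleftrightarrow> polar p = 0" if "p \<in> klein_quadric" for p
    proof -
      have "cfun.span {W p} \<in> proj_space"
        using W_inj[OF that] by (auto simp: proj_space_def)
      then show ?thesis
        using that P(2)[of p] by (simp add: zero_locus_def zero_on_line_iff[OF P(1)] klein_quadric_def)
    qed
    then show ?thesis
      using wronski_image_props(2) by (auto simp: wronski_image_eq)
  qed
  have "openin zariski (proj_space - zero_locus {P})"
    unfolding openin_zariski using P(1) by blast
  then have "openin ?X ?U"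
    unfolding U_eq by (rule openin_subtopology_Int)
  moreover have "?X closure_of ?U = topspace ?X"
    unfolding dense_intersects_open
  proof (intro allI impI)
    fix T assume T: "openin ?X T \<and> T \<noteq> {}"
    then obtain F where F: "\<forall>p\<in>F. \<exists>d. homog_poly d p"
      "T = (proj_space - zero_locus F) \<inter> wronski_image I L 2"
      by (auto simp: openin_subtopology openin_zariski)
    then obtain p where p: "p \<in> klein_quadric" "cfun.span {W p} \<in> proj_space" "cfun.span {W p} \<notin> zero_locus F"
      using T by (auto simp: wronski_image_eq)
    then obtain Q where "Q \<in> F" "\<not> (\<forall>x\<in>cfun.span {W p}. Q x = 0)"
      by (auto simp: zero_locus_def)
    moreover from this F(1) obtain d where "homog_poly d Q" by blast
    ultimately have Q: "Q \<in> F" "homog_poly d Q" "Q (W p) \<noteq> 0"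
      using zero_on_line_iff[of d Q "W p"] by simp_all
    have in_T: "cfun.span {W q} \<in> T" if "q \<in> klein_quadric" "Q (W q) \<noteq> 0" for q
    proof -
      have "cfun.span {W q} \<in> wronski_image I L 2"
        using that(1) by (simp add: wronski_image_eq)
      moreover have "cfun.span {W q} \<notin> zero_locus F"
        using that(2) Q(1) zero_on_line_iff[OF Q(2), of "W q"] by (auto simp: zero_locus_def)
      ultimately show ?thesis
        using wronski_image_props(2) by (simp add: F(2) subset_iff)
    qed
    show "?U \<inter> T \<noteq> {}"
    proof (cases "polar p = 0")
      case False
      then show ?thesis using in_T[OF p(1) Q(3)] p(1) by blast
    next
      case True
      obtain a b where ab: "p = wedge a b"
        using klein_quadric_decomposable[OF p(1)] .
      with p(1) have "wedge a b \<noteq> 0" by (simp add: klein_quadric_def)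
      then obtain c where c: "polar (wedge c b) \<noteq> 0"
        by (rule polar_nondegenerate)
      obtain z where z: "z \<noteq> 0" "Q (W p + cscale z (W (wedge c b))) \<noteq> 0"
        using homog_poly_nonzero_on_line[OF Q(2,3)] by blast
      define q where "q = wedge (\<lambda>k. a k + z * c k) b"
      have q: "q = p + scale_bivector z (wedge c b)"
        by (simp add: q_def ab wedge_def scale_bivector_def fun_eq_iff algebra_simps)
      have "polar q = polar p + z * polar (wedge c b)"
        by (simp add: q polar_def scale_bivector_def algebra_simps)
      with True z(1) c have polar_q: "polar q \<noteq> 0" by simp
      then have "q \<noteq> 0" by (auto simp: polar_def)
      then have q_klein: "q \<in> klein_quadric"
        unfolding q_def by (rule wedge_in_klein_quadric)
      moreover have "Q (W q) \<noteq> 0"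
        using z(2) by (simp add: q pencil_add pencil_scale)
      ultimately show ?thesis
        using in_T polar_q by blast
    qed
  qed
  moreover have "topspace ?X = wronski_image I L 2"
    using wronski_image_props(2) by (simp add: topspace_zariski Int_absorb1)
  moreover have "finite {\<Lambda> \<in> grassmannian 2 V. wronski_map I \<Lambda> = y} \<and>
      card {\<Lambda> \<in> grassmannian 2 V. wronski_map I \<Lambda> = y} = 2" if "y \<in> ?U" for y
  proof -
    from that obtain p where p: "p \<in> klein_quadric" "polar p \<noteq> 0" "y = cfun.span {W p}"
      by blast
    show ?thesis
      unfolding p(3) fibre_pair[OF W_centre p(1)]
      using planes_distinct[OF W_centre p(1,2)] by simp
  qed
  ultimately show "generic_fibre_card I L 2 ?U 2"
    unfolding generic_fibre_card_def by simp
qed (rule wronski_image_props)+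

lemma degree_iff: "wronski_degree I L 2 > 1 \<longleftrightarrow> W centre = 0"
  using degree_1 degree_2 by (cases "W centre = 0") auto

end


section \<open>The degree and self-adjointness\<close>

context fundamental_system
begin

text \<open>The terms with \<open>\<mu>'\<close> cancel by antisymmetry.\<close>
lemma pencil_twist:
  assumes p: "antisymmetric p" and \<mu>: "smooth_on I \<mu>" and t: "t \<in> I"
  shows "pencil (\<lambda>k u. \<mu> u * g k u) p t = (\<mu> t)\<^sup>2 * jet p 0 1 t"
proof -
  have D: "nderiv I 1 (\<lambda>u. \<mu> u * g l u) t = \<mu> t * nderiv I 1 (g l) t + nderiv I 1 \<mu> t * g l t" for l
    using nderiv_mult[OF \<mu> g_smooth t, of 1] by simp
  have "pencil (\<lambda>k u. \<mu> u * g k u) p t =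
      (\<Sum>k\<in>UNIV. \<Sum>l\<in>UNIV. (\<mu> t)\<^sup>2 * (p k l * g k t * nderiv I 1 (g l) t)
        + \<mu> t * nderiv I 1 \<mu> t * (p k l * g k t * g l t))"
    unfolding pencil_def D by (intro sum.cong refl) (simp add: power2_eq_square algebra_simps)
  also have "\<dots> = (\<mu> t)\<^sup>2 * jet p 0 1 t + \<mu> t * nderiv I 1 \<mu> t * jet p 0 0 t"
    by (simp only: sum.distrib sum_distrib_left[symmetric] jet_def nderiv_0)
  finally show ?thesis
    using jet_diag[OF p, of 0 t] by simp
qed

text \<open>The solutions of \<open>L\<close> are the products of \<open>\<mu>\<close> with the solutions of \<open>M\<close>, so the functions
  \<open>\<mu> * g k\<close> are a basis of the solution space of \<open>L\<close>, and the bivectors annihilated by the Wronskian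
  are the ones found for \<open>M\<close>.\<close>
lemma degree_of_equivalent:
  assumes \<mu>: "smooth_on I \<mu>" "\<And>t. t \<in> I \<Longrightarrow> \<mu> t \<noteq> 0"
    and equiv: "\<And>x t. x \<in> Cinf I \<Longrightarrow> t \<in> I \<Longrightarrow> ldo_apply I M x t = 1 / \<mu> t * ldo_apply I L (\<lambda>u. \<mu> u * x u) t"
  shows "wronski_degree I L 2 > 1 \<longleftrightarrow> (\<forall>t\<in>I. b 1 t = nderiv I 1 (b 2) t)"
proof -
  define f where "f k = (\<lambda>u. \<mu> u * g k u)" for k
  have comb_f: "comb f a = (\<lambda>u. \<mu> u * comb g a u)" for a
    by (simp add: comb_def f_def fun_eq_iff sum_distrib_left mult_ac)
  have f_Cinf: "f k \<in> Cinf I" for k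
    unfolding f_def by (rule Cinf_mult[OF \<mu>(1) g_Cinf])
  have pencil_0: "pencil f p = 0 \<longleftrightarrow> (\<forall>t\<in>I. jet p 0 1 t = 0)" if "antisymmetric p" for p
  proof -
    have outside: "pencil f p t = 0" if "t \<notin> I" for t
      using f_Cinf that by (simp add: pencil_def Cinf_def)
    have inside: "pencil f p t = (\<mu> t)\<^sup>2 * jet p 0 1 t" if "t \<in> I" for t
      using pencil_twist[OF \<open>antisymmetric p\<close> \<mu>(1) that] by (simp add: f_def[abs_def])
    show ?thesis
    proof (intro iffI ballI)
      fix t assume "pencil f p = 0" "t \<in> I"
      then show "jet p 0 1 t = 0"
        using inside[of t] \<mu>(2)[of t] by simp
    next
      assume zero: "\<forall>t\<in>I. jet p 0 1 t = 0"
      show "pencil f p = 0"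
      proof
        show "pencil f p t = 0 t" for t
          using zero inside[of t] outside[of t] by (cases "t \<in> I") simp_all
      qed
    qed
  qed
  interpret wronskian_pencil I L f "b 2 s"
  proof
    show "sol_space I L = range (comb f)"
    proof (intro equalityI subsetI)
      fix y assume "y \<in> sol_space I L"
      then have y: "y \<in> Cinf I" "\<And>t. t \<in> I \<Longrightarrow> ldo_apply I L y t = 0"
        by (auto simp: sol_space_def)
      define x where "x = (\<lambda>u. inverse (\<mu> u) * y u)"
      have x: "x \<in> Cinf I"
        unfolding x_def by (rule Cinf_mult[OF smooth_on_inverse[OF \<mu>] y(1)])
      have "y t = 0" if "t \<notin> I" for t using y(1) that by (simp add: Cinf_def)
      then have y_eq: "y = (\<lambda>u. \<mu> u * x u)"
        using \<mu>(2) by (fastforce simp: x_def)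
      have "x \<in> sol_space I M"
        using x y(2) equiv[OF x] unfolding y_eq[symmetric] by (simp add: sol_space_def)
      then show "y \<in> range (comb f)"
        unfolding sol_space_eq using y_eq comb_f by auto
    next
      fix y assume "y \<in> range (comb f)"
      then obtain a where a: "y = (\<lambda>u. \<mu> u * comb g a u)" using comb_f by auto
      have x: "comb g a \<in> sol_space I M" unfolding sol_space_eq by blast
      then have "comb g a \<in> Cinf I" by (simp add: sol_space_def)
      then show "y \<in> sol_space I L"
        using x equiv \<mu> unfolding a by (auto simp: sol_space_def Cinf_mult)
    qed
    show "f k \<in> Cinf I" for k by (rule f_Cinf)
    show "a = 0" if "comb f a = 0" for a
    proof -
      have "comb g a t = 0" for t
      proof (cases "t \<in> I")
        case True
        have "\<mu> t * comb g a t = comb f a t" by (simp add: comb_f)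
        also have "\<dots> = 0" by (simp add: that)
        finally show ?thesis using \<mu>(2)[OF True] by simp
      next
        case False
        then show ?thesis using comb_Cinf[of g a] g_Cinf by (simp add: Cinf_def)
      qed
      then show ?thesis using comb_eq_0_iff[of a] by (simp add: fun_eq_iff)
    qed
    show "p 0 1 = 0 \<and> p 0 2 = 0 \<and> p 1 3 = 0 \<and> p 0 3 = - p 1 2 \<and> p 2 3 = b 2 s * p 1 2"
      if "antisymmetric p" "pencil f p = 0" for p
      using kernel_jets(1-5)[OF that(1)] that pencil_0 by blast
  qed
  show ?thesis
    unfolding degree_iff pencil_0[OF antisymmetric_centre]
  proof
    assume "\<forall>t\<in>I. jet centre 0 1 t = 0"
    then show "\<forall>t\<in>I. b 1 t = nderiv I 1 (b 2) t"
      using kernel_jets(6)[OF antisymmetric_centre] by (simp add: centre_entries)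
  next
    assume "\<forall>t\<in>I. b 1 t = nderiv I 1 (b 2) t"
    then show "\<forall>t\<in>I. jet centre 0 1 t = 0"
      using kernel_exists[OF antisymmetric_centre] by (simp add: centre_entries)
  qed
qed

end

text \<open>A self-adjoint operator of order 4 is automatically reduced, and every \<open>L\<close> of order 4 is
  equivalent to a reduced operator. So this criterion settles both directions of the theorem.\<close>
lemma degree_of_reduced_form:
  assumes I: "nondegenerate_interval I" and M: "ldo_on I M" "ldo_order M = 4"
    and reduced: "\<And>t. t \<in> I \<Longrightarrow> ldo_coeff M 3 t = 0" and equiv: "ldo_equivalent I L M"
  shows "wronski_degree I L 2 > 1 \<longleftrightarrow> ldo_self_adjoint I M"
proof -
  interpret interval I by standard (rule I)
  obtain s where "s \<in> I"
    using I interior_subset by (fastforce simp: nondegenerate_interval_def)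
  interpret reduced_operator I M s
    by standard (use M reduced \<open>s \<in> I\<close> in auto)
  obtain g where "fundamental_system I M s g"
    using fundamental_system_exists by blast
  then interpret fundamental_system I M s g .
  show ?thesis
    using equiv degree_of_equivalent self_adjoint_order_4_iff[OF M] reduced
    unfolding ldo_equivalent_def by blast
qed

theorem theorem1p4:
  fixes I :: "real set" and L :: ldo
  assumes "is_interval I" and "interior I \<noteq> {}"
    and "ldo_on I L" and "ldo_order L = 4"
  shows "wronski_degree I L 2 > 1 \<longleftrightarrow>
    (\<exists>M. ldo_on I M \<and> ldo_self_adjoint I M \<and> ldo_equivalent I L M)"
proof
  have I: "nondegenerate_interval I"
    using assms(1,2) by (simp add: nondegenerate_interval_def)
  interpret interval I by standard (rule I)
  {
    assume deg: "wronski_degree I L 2 > 1"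
    obtain M where M: "ldo_on I M" "ldo_order M = Suc 3" "\<And>t. t \<in> I \<Longrightarrow> ldo_coeff M 3 t = 0"
      "ldo_equivalent I L M"
      using ldo_reduced_form[OF assms(3), of 3] assms(4) by auto
    then show "\<exists>M. ldo_on I M \<and> ldo_self_adjoint I M \<and> ldo_equivalent I L M"
      using degree_of_reduced_form[OF I, of M L] deg by auto
  }
  assume "\<exists>M. ldo_on I M \<and> ldo_self_adjoint I M \<and> ldo_equivalent I L M"
  then obtain M where M: "ldo_on I M" "ldo_self_adjoint I M" "ldo_equivalent I L M"
    by blast
  have order: "ldo_order M = 4"
    using ldo_equivalent_order[OF M(3)] assms(4) by simp
  then have "\<And>t. t \<in> I \<Longrightarrow> ldo_coeff M 3 t = 0"
    using self_adjoint_order_4_iff[OF M(1)] M(2) by blast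
  then show "wronski_degree I L 2 > 1"
    using degree_of_reduced_form[OF I M(1) order _ M(3)] M(2) by blast
qed

end
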